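(* Let $p$ be a prime, $r\ge1$ and $q\ge1$ integers, and fix any monomial order on $\mathbb{Z}_{p^r}[x]^q$. Let $M$ be a nonzero submodule of $\mathbb{Z}_{p^r}[x]^q$ with minimal Gröbner basis $G=\{g_1,\dots,g_m\}$, ordered so that $\mathrm{lm}(g_1)>\dots>\mathrm{lm}(g_m)$. Let $(\beta_1,\dots,\beta_m)$ be the sequence of order differences of $G$, let $N=\beta_1+\dots+\beta_m$, and let $(v_1,\dots,v_N)$ be the sequence $$(g_1,pg_1,\dots,p^{\beta_1-1}g_1,\ g_2,pg_2,\dots,p^{\beta_2-1}g_2,\ \dots,\ g_m,pg_m,\dots,p^{\beta_m-1}g_m).$$ Then $\{v_1,\dots,v_N\}$ has the $p$-Predictable Leading Monomial ($p$-PLM) property. In particular, $(v_1,\dots,v_N)$ is a $p$-basis of $M$, so that the $p$-dimension of $M$ equals $N=\beta_1+\beta_2+\dots+\beta_m$.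
   Context: Let $\mathcal{R}=\mathbb{Z}_{p^r}=\mathbb{Z}/p^r\mathbb{Z}$ and let $\mathrm{e}_1,\dots,\mathrm{e}_q$ be the unit vectors in $\mathcal{R}^q$. Monomials of $\mathcal{R}[x]^q$ are the elements $x^\alpha \mathrm{e}_i$ with $\alpha\in\mathbb{N}_0$, $1\le i\le q$. A monomial order is a total order on the monomials such that $X<x^{\gamma}X$ for every monomial $X$ and every $\gamma\ge1$, and $X<Y$ implies $x^\gamma X<x^\gamma Y$ for all $\gamma\ge 0$ (e.g. TOP: $x^\alpha \mathrm{e}_i<x^\beta \mathrm{e}_j$ iff $\alpha<\beta$ or ($\alpha=\beta$ and $i>j$); POT: $x^\alpha \mathrm{e}_i<x^\beta \mathrm{e}_j$ iff $i>j$ or ($i=j$ and $\alpha<\beta$)). Every nonzero $f\in\mathcal{R}[x]^q$ is uniquely $f=\sum_{i=1}^L c_iX_i$ with nonzero $c_i\in\mathcal{R}$ and monomials $X_1>\dots>X_L$. Put $\mathrm{lm}(f)=X_1$, $\mathrm{lt}(f)=c_1X_1$, $\mathrm{lc}(f)=c_1$; if $X_1=x^{\alpha}\mathrm{e}_{i}$, then $\mathrm{lpos}(f)=i$ and $\deg(f)=\alpha$. For a nonzero polynomial $a\in\mathcal{R}[x]$, $\mathrm{lm}(a)=x^{\deg a}$. For a set $F$ of nonzero vectors, $\mathrm{L}(F)$ is the submodule generated by $\{\mathrm{lt}(f):f\in F\}$, and $\mathrm{L}(M)$ is the submodule generated by the leading terms of all nonzero elements of $M$. A finite set $G\subseteq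 M$ of nonzero vectors is a Gröbner basis of $M$ if $\mathrm{L}(G)=\mathrm{L}(M)$. A nonzero $f$ can be reduced modulo a set $F$ of nonzero vectors if there are $f_1,\dots,f_s\in F$ ($s\ge1$), $\alpha_i\in\mathbb{N}_0$ and $c_i\in\mathcal{R}$ with $\mathrm{lm}(f)=x^{\alpha_i}\mathrm{lm}(f_i)$ for all $i$ and $\mathrm{lt}(f)=\sum_{i=1}^s c_ix^{\alpha_i}\mathrm{lt}(f_i)$; otherwise $f$ is minimal with respect to $F$. A Gröbner basis $G$ is minimal if each $g\in G$ is minimal with respect to $G\setminus\{g\}$. The leading monomials of the elements of a minimal Gröbner basis are pairwise distinct. Order: an element $a\in\mathbb{Z}_{p^r}$ has order $k$ if the additive subgroup generated by $a$ has $p^k$ elements; for nonzero $f\in\mathbb{Z}_{p^r}[x]^q$, $\mathrm{ord}(f)$ is the order of $\mathrm{lc}(f)$. Sequence of order differences of $G=\{g_1,\dots,g_m\}$ (ordered with $\mathrm{lm}(g_1)>\dots>\mathrm{lm}(g_m)$): for $1\le j\le m$, $\beta_j:=\mathrm{ord}(g_j)-\mathrm{ord}(g_i)$, where $i$ is the smallest integer $>j$ with $\mathrm{lpos}(g_i)=\mathrm{lpos}(g_j)$; if no such $i$ exists, $\beta_j:=\mathrm{ord}(g_j)$. All $\beta_j$ are positive integers. Let $\mathcal{A}_p=\{0,1,\dots,p-1\}\subset\mathbb{Z}_{p^r}$ and let $\mathcal{A}_p[x]$ be the set of polynomials in $\mathbb{Z}_{p^r}[x]$ with all coefficients in $\mathcal{A}_p$.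 A $p$-linear combination of $v_1,\dots,v_N\in\mathbb{Z}_{p^r}[x]^q$ is a vector $\sum_{j=1}^N a_jv_j$ with all $a_j\in\mathcal{A}_p[x]$ (arithmetic in $\mathbb{Z}_{p^r}$); the $p$-span is the set of all $p$-linear combinations. The sequence $(v_1,\dots,v_N)$ is a $p$-generator sequence if $pv_N=0$ and $pv_i$ is a $p$-linear combination of $v_{i+1},\dots,v_N$ for $1\le i\le N-1$. The vectors $v_1,\dots,v_N$ are $p$-linearly independent if the only $p$-linear combination of them equal to zero is the trivial one. A $p$-basis of $M$ is a $p$-generator sequence whose $p$-span is $M$ and whose vectors are $p$-linearly independent; the number of elements of a $p$-basis of $M$ is the $p$-dimension of $M$. $p$-PLM property: a nonempty finite subset $F=\{f_1,\dots,f_s\}$ of $M$ has the $p$-PLM property if for any $0\ne f\in M$ and any expression $f=a_1f_1+\dots+a_sf_s$ with $a_1,\dots,a_s\in\mathcal{A}_p[x]$ one has $\mathrm{lm}(f)=\max_{1\le i\le s;\,a_i\neq0}\bigl(\mathrm{lm}(a_i)\,\mathrm{lm}(f_i)\bigr)$. *)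

theory Defs
  imports
    "HOL-Analysis.Finite_Cartesian_Product"
    "HOL-Computational_Algebra.Group_Closure"
    "Berlekamp_Zassenhaus.Finite_Field"
begin

text \<open>
  The ring of integers modulo \<open>p ^ r\<close> is \<^typ>\<open>'a mod_ring\<close> with \<open>CARD('a) = p ^ r\<close>, and the free
  module of rank \<open>q\<close> over its polynomial ring is \<open>'a mod_ring poly ^ 'q\<close> with \<open>q = CARD('q)\<close>.
  Submodules and generated submodules are \<^const>\<open>Modules.module.subspace\<close> and \<^const>\<open>Modules.module.span\<close> for the
  componentwise scaling \<open>(*s)\<close>, which satisfies the module axioms over any commutative ring:
\<close>

lemma module_vector_scalar_mult:
  "Modules.module ((*s) :: 'a::comm_ring_1 \<Rightarrow> 'a ^ 'n::finite \<Rightarrow> 'a ^ 'n)"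
  by unfold_locales (simp_all add: vector_scalar_mult_def vec_eq_iff algebra_simps)

type_synonym ('a, 'q) polyvec = "('a mod_ring poly, 'q) vec"


section \<open>Monomials and leading terms\<close>

text \<open>The pair \<open>(\<alpha>, i)\<close> encodes the monomial \<open>x\<^sup>\<alpha> e\<^sub>i\<close>.\<close>

type_synonym 'q monomial = "nat \<times> 'q"

definition mon_shift :: "nat \<Rightarrow> 'q monomial \<Rightarrow> 'q monomial" where
  "mon_shift \<gamma> X = (fst X + \<gamma>, snd X)"

definition mon_term :: "'a::nontriv mod_ring \<Rightarrow> 'q monomial \<Rightarrow> ('a, 'q::finite) polyvec" where
  "mon_term c X = axis (snd X) (monom c (fst X))"

definition strict_part :: "('b \<Rightarrow> 'b \<Rightarrow> bool) \<Rightarrow> 'b \<Rightarrow> 'b \<Rightarrow> bool" where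
  "strict_part mle X Y \<longleftrightarrow> mle X Y \<and> X \<noteq> Y"

definition monomial_order :: "('q monomial \<Rightarrow> 'q monomial \<Rightarrow> bool) \<Rightarrow> bool" where
  "monomial_order mle \<longleftrightarrow>
     class.linorder mle (strict_part mle) \<and>
     (\<forall>X. \<forall>\<gamma>\<ge>1. strict_part mle X (mon_shift \<gamma> X)) \<and>
     (\<forall>X Y \<gamma>. strict_part mle X Y \<longrightarrow> strict_part mle (mon_shift \<gamma> X) (mon_shift \<gamma> Y))"

definition mon_coeff :: "('a::nontriv, 'q::finite) polyvec \<Rightarrow> 'q monomial \<Rightarrow> 'a mod_ring" where
  "mon_coeff f X = coeff (f $ snd X) (fst X)"

text \<open>
  The following leading data are meaningful for \<open>f \<noteq> 0\<close> only. \<^const>\<open>linorder.Max\<close> takes the order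
  as an explicit argument.
\<close>

definition lm :: "('q monomial \<Rightarrow> 'q monomial \<Rightarrow> bool) \<Rightarrow> ('a::nontriv, 'q::finite) polyvec \<Rightarrow> 'q monomial" where
  "lm mle f = linorder.Max mle {X. mon_coeff f X \<noteq> 0}"

definition lc :: "('q monomial \<Rightarrow> 'q monomial \<Rightarrow> bool) \<Rightarrow> ('a::nontriv, 'q::finite) polyvec \<Rightarrow> 'a mod_ring" where
  "lc mle f = mon_coeff f (lm mle f)"

definition lt :: "('q monomial \<Rightarrow> 'q monomial \<Rightarrow> bool) \<Rightarrow> ('a::nontriv, 'q::finite) polyvec \<Rightarrow> ('a, 'q) polyvec" where
  "lt mle f = mon_term (lc mle f) (lm mle f)"

definition lpos :: "('q monomial \<Rightarrow> 'q monomial \<Rightarrow> bool) \<Rightarrow> ('a::nontriv, 'q::finite) polyvec \<Rightarrow> 'q" where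
  "lpos mle f = snd (lm mle f)"


section \<open>Minimal Groebner bases\<close>

definition lt_module ::
    "('q monomial \<Rightarrow> 'q monomial \<Rightarrow> bool) \<Rightarrow> ('a::nontriv, 'q::finite) polyvec set \<Rightarrow> ('a, 'q) polyvec set" where
  "lt_module mle F = Modules.module.span (*s) (lt mle ` (F - {0}))"

definition groebner_basis ::
    "('q monomial \<Rightarrow> 'q monomial \<Rightarrow> bool) \<Rightarrow> ('a::nontriv, 'q::finite) polyvec set \<Rightarrow> ('a, 'q) polyvec set \<Rightarrow> bool" where
  "groebner_basis mle M G \<longleftrightarrow>
     finite G \<and> G \<subseteq> M \<and> 0 \<notin> G \<and> lt_module mle G = lt_module mle M"

definition reducible_mod ::
    "('q monomial \<Rightarrow> 'q monomial \<Rightarrow> bool) \<Rightarrow> ('a::nontriv, 'q::finite) polyvec \<Rightarrow> ('a, 'q) polyvec set \<Rightarrow> bool" where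
  "reducible_mod mle f F \<longleftrightarrow>
     (\<exists>s\<ge>1. \<exists>(h :: nat \<Rightarrow> ('a, 'q) polyvec) (\<alpha> :: nat \<Rightarrow> nat) (c :: nat \<Rightarrow> 'a mod_ring).
        (\<forall>i<s. h i \<in> F \<and> lm mle f = mon_shift (\<alpha> i) (lm mle (h i))) \<and>
        lt mle f = (\<Sum>i<s. monom (c i) (\<alpha> i) *s lt mle (h i)))"

definition minimal_groebner_basis ::
    "('q monomial \<Rightarrow> 'q monomial \<Rightarrow> bool) \<Rightarrow> ('a::nontriv, 'q::finite) polyvec set \<Rightarrow> ('a, 'q) polyvec set \<Rightarrow> bool" where
  "minimal_groebner_basis mle M G \<longleftrightarrow>
     groebner_basis mle M G \<and> (\<forall>g\<in>G. \<not> reducible_mod mle g (G - {g}))"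


section \<open>Order differences\<close>

definition elem_order :: "nat \<Rightarrow> 'a::nontriv mod_ring \<Rightarrow> nat" where
  "elem_order p a = (THE k. card (group_closure {a}) = p ^ k)"

definition vec_order ::
    "('q monomial \<Rightarrow> 'q monomial \<Rightarrow> bool) \<Rightarrow> nat \<Rightarrow> ('a::nontriv, 'q::finite) polyvec \<Rightarrow> nat" where
  "vec_order mle p f = elem_order p (lc mle f)"

text \<open>
  Indices start at 0. If \<open>gs\<close> enumerates a minimal Groebner basis with decreasing leading monomials,
  the orders strictly decrease along elements with equal leading position, so that the subtraction
  of natural numbers is the true difference.
\<close>

definition order_diff ::
    "('q monomial \<Rightarrow> 'q monomial \<Rightarrow> bool) \<Rightarrow> nat \<Rightarrow> ('a::nontriv, 'q::finite) polyvec list \<Rightarrow> nat \<Rightarrow> nat" where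
  "order_diff mle p gs j =
     (let I = {i. j < i \<and> i < length gs \<and> lpos mle (gs ! i) = lpos mle (gs ! j)}
      in if I = {} then vec_order mle p (gs ! j)
         else vec_order mle p (gs ! j) - vec_order mle p (gs ! Min I))"

definition order_diffs ::
    "('q monomial \<Rightarrow> 'q monomial \<Rightarrow> bool) \<Rightarrow> nat \<Rightarrow> ('a::nontriv, 'q::finite) polyvec list \<Rightarrow> nat list" where
  "order_diffs mle p gs = map (order_diff mle p gs) [0..<length gs]"

text \<open>The sequence \<open>g\<^sub>1, p g\<^sub>1, \<dots>, p\<^bsup>\<beta>\<^sub>1 - 1\<^esup> g\<^sub>1, g\<^sub>2, p g\<^sub>2, \<dots>\<close>.\<close>

definition expanded_seq ::
    "('q monomial \<Rightarrow> 'q monomial \<Rightarrow> bool) \<Rightarrow> nat \<Rightarrow> ('a::nontriv, 'q::finite) polyvec list \<Rightarrow> ('a, 'q) polyvec list" where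
  "expanded_seq mle p gs =
     concat (map (\<lambda>j. map (\<lambda>k. of_nat (p ^ k) *s (gs ! j)) [0..<order_diffs mle p gs ! j]) [0..<length gs])"


section \<open>\<open>p\<close>-bases and the \<open>p\<close>-predictable leading monomial property\<close>

definition digits :: "nat \<Rightarrow> 'a::nontriv mod_ring set" where
  "digits p = of_nat ` {0..<p}"

definition digit_polys :: "nat \<Rightarrow> 'a::nontriv mod_ring poly set" where
  "digit_polys p = {a. \<forall>n. coeff a n \<in> digits p}"

definition p_span :: "nat \<Rightarrow> ('a::nontriv, 'q::finite) polyvec list \<Rightarrow> ('a, 'q) polyvec set" where
  "p_span p vs = {\<Sum>j<length vs. a j *s vs ! j |a. \<forall>j<length vs. a j \<in> digit_polys p}"

definition p_generator_seq :: "nat \<Rightarrow> ('a::nontriv, 'q::finite) polyvec list \<Rightarrow> bool" where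
  "p_generator_seq p vs \<longleftrightarrow>
     vs \<noteq> [] \<and> of_nat p *s last vs = 0 \<and>
     (\<forall>i. Suc i < length vs \<longrightarrow> of_nat p *s (vs ! i) \<in> p_span p (drop (Suc i) vs))"

definition p_lin_indep :: "nat \<Rightarrow> ('a::nontriv, 'q::finite) polyvec list \<Rightarrow> bool" where
  "p_lin_indep p vs \<longleftrightarrow>
     (\<forall>a. (\<forall>j<length vs. a j \<in> digit_polys p) \<and> (\<Sum>j<length vs. a j *s vs ! j) = 0
        \<longrightarrow> (\<forall>j<length vs. a j = 0))"

definition p_basis ::
    "nat \<Rightarrow> ('a::nontriv, 'q::finite) polyvec set \<Rightarrow> ('a, 'q) polyvec list \<Rightarrow> bool" where
  "p_basis p M vs \<longleftrightarrow> p_generator_seq p vs \<and> p_span p vs = M \<and> p_lin_indep p vs"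

text \<open>
  The definite description includes that all \<open>p\<close>-bases of \<open>M\<close> have the same length; without this
  its value is unspecified.
\<close>

definition p_dim :: "nat \<Rightarrow> ('a::nontriv, 'q::finite) polyvec set \<Rightarrow> nat" where
  "p_dim p M = (THE n. \<exists>vs. p_basis p M vs \<and> length vs = n)"

text \<open>
  The clause \<open>0 \<notin> F\<close> is what makes the leading monomials on the right-hand side meaningful.
\<close>

definition p_PLM ::
    "('q monomial \<Rightarrow> 'q monomial \<Rightarrow> bool) \<Rightarrow> nat \<Rightarrow> ('a::nontriv, 'q::finite) polyvec set \<Rightarrow> ('a, 'q) polyvec set \<Rightarrow> bool" where
  "p_PLM mle p M F \<longleftrightarrow>
     F \<noteq> {} \<and> finite F \<and> F \<subseteq> M \<and> 0 \<notin> F \<and>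
     (\<forall>f\<in>M. \<forall>a. f \<noteq> 0 \<and> (\<forall>v\<in>F. a v \<in> digit_polys p) \<and> f = (\<Sum>v\<in>F. a v *s v)
        \<longrightarrow> lm mle f = linorder.Max mle {mon_shift (degree (a v)) (lm mle v) |v. v \<in> F \<and> a v \<noteq> 0})"

end

theory Submission
  imports Defs "HOL-Number_Theory.Cong"
begin

text \<open>
  Order the pairs \<open>(lm f, ord f)\<close> lexicographically. A sum of nonzero vectors with pairwise distinct pairs
  has the largest of these pairs. In the expanded sequence \<open>g\<^sub>1, p g\<^sub>1, \<dots>\<close> the vectors with the same leading
  position have distinct orders, by minimality of the basis, and multiplying a vector by \<open>x\<^sup>\<alpha>\<close> and by nonzero
  digits keeps its order; so the terms of a \<open>p\<close>-linear combination have distinct pairs, which is the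
  \<open>p\<close>-PLM property. Conversely the orders of the expanded sequence leave no gaps, so the pair of any nonzero
  \<open>f \<in> M\<close> can be lowered by subtracting \<open>d x\<^sup>\<alpha> v\<^sub>j\<close> for a digit \<open>d\<close>, and \<open>f\<close> is reached by well-founded
  induction. All \<open>p\<close>-bases have the same length because a \<open>p\<close>-basis of length \<open>n\<close> has \<open>p\<^bsup>dn\<^esup>\<close> combinations
  of degree below \<open>d\<close>.
\<close>

section \<open>Orders of elements of \<open>\<int> / p\<^sup>r\<close>\<close>

text \<open>Leading monomials alone cannot exclude cancellation: the nonzero vectors among
  \<open>g, p g, p^2 g, ...\<close> share one leading monomial, and the coefficient ring has zero
  divisors. Orders separate them because they behave like an ultrametric: the order of a sum is the
  larger of the two orders when these differ.

  The persistent obstacle is that digits are not closed under addition, so neither the submodule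
  property of a p-span nor the uniqueness of digit combinations is immediate. For spanning, carries
  are avoided: the digit to be added always lands on a coefficient known to be zero. For uniqueness
  and for counting they cannot be avoided, and the generator-sequence property has to absorb them.
  Counting is truncated by degree because M itself is infinite; carries and the passage between two
  p-bases then cost a constant in the degree, independent of d, and a constant cannot make up for a
  missing generator.\<close>

locale prime_power_mod =
  fixes p r :: nat and R :: "'a::nontriv itself"
  assumes prime: "prime p" and card: "CARD('a) = p ^ r"
begin

abbreviation ord :: "'a mod_ring \<Rightarrow> nat" where
  "ord \<equiv> elem_order p"

lemma p_gt_1: "p > 1"
  using prime by (rule prime_gt_1_nat)

lemma of_nat_mod_ring_eq_0_iff: "(of_nat n :: 'a mod_ring) = 0 \<longleftrightarrow> p ^ r dvd n"
  by (simp add: of_nat_eq_0_iff_char_dvd card)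

lemma mod_ring_eq_of_nat: "\<exists>n. (c :: 'a mod_ring) = of_nat n"
proof -
  have "c = of_int_mod_ring (to_int_mod_ring c)"
    by simp
  also have "\<dots> = of_nat (nat (to_int_mod_ring c))"
    using range_to_int_mod_ring[where 'a = 'a] rangeI[of to_int_mod_ring c]
    by (metis atLeastLessThan_iff int_nat_eq of_int_of_int_mod_ring of_int_of_nat_eq)
  finally show ?thesis
    by blast
qed

lemma of_nat_dvd_1:
  assumes "\<not> p dvd n"
  shows "(of_nat n :: 'a mod_ring) dvd 1"
proof -
  have "coprime n (p ^ r)"
    using assms prime by (meson coprime_commute coprime_power_right_iff prime_imp_coprime)
  then obtain w where "[n * w = 1] (mod p ^ r)"
    using cong_solve_coprime_nat by (metis One_nat_def)
  then have "(of_nat (n * w) :: 'a mod_ring) = of_nat 1"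
    by (simp only: of_nat_eq_iff_cong_CHAR semiring_char_mod_ring card)
  then show ?thesis
    by (simp add: dvd_def) metis
qed

text \<open>The exponent is the multiplicity of p in a natural representative. Zero is covered by
  \<open>s = r\<close>, \<open>u = 1\<close>, so later lemmas need not treat it separately.\<close>

lemma prime_power_unit_decomp:
  obtains s u where "s \<le> r" "u dvd 1" "(c :: 'a mod_ring) = of_nat (p ^ s) * u"
proof -
  obtain n where n: "c = of_nat n"
    using mod_ring_eq_of_nat by blast
  show thesis
  proof (cases "p ^ r dvd n")
    case True
    then have "c = of_nat (p ^ r) * 1"
      using n by (simp only: of_nat_mod_ring_eq_0_iff[THEN iffD2] dvd_refl mult_zero_left)
    then show thesis
      using that[of r 1] by simp
  next
    case False
    then have "n \<noteq> 0"
      by (metis dvd_0_right)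
    then obtain m where m: "n = p ^ multiplicity p n * m" "\<not> p dvd m"
      using multiplicity_decompose'[of n p] p_gt_1 by auto
    have "multiplicity p n \<le> r"
      using False multiplicity_dvd'[of r p n] by linarith
    moreover have "(of_nat m :: 'a mod_ring) dvd 1"
      using m(2) by (rule of_nat_dvd_1)
    moreover have "c = of_nat (p ^ multiplicity p n) * of_nat m"
      unfolding n by (subst m(1)) simp
    ultimately show thesis
      using that by blast
  qed
qed

lemma unit_mult_eq_0_iff:
  fixes u c :: "'b::comm_semiring_1"
  assumes "u dvd 1"
  shows "c * u = 0 \<longleftrightarrow> c = 0"
proof -
  obtain w where "u * w = 1"
    using assms by (metis dvdE)
  then have "c = c * u * w"
    by (simp add: mult.assoc)
  then show ?thesis
    by auto
qed

text \<open>A multiple \<open>n c\<close> vanishes exactly when \<open>p^(r - s)\<close> divides n,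
  so the cyclic group of c consists of the \<open>n c\<close> with n below that number, all
  distinct.\<close>

lemma elem_order_eqI:
  fixes u :: "'a mod_ring"
  assumes "s \<le> r" "u dvd 1"
  shows "ord (of_nat (p ^ s) * u) = r - s"
proof -
  define c where "c = of_nat (p ^ s) * u"
  define N where "N = p ^ (r - s)"
  have N: "N > 0"
    using p_gt_1 by (simp add: N_def)
  have "of_nat n * c = 0 \<longleftrightarrow> N dvd n" for n
  proof -
    have "of_nat n * c = of_nat (n * p ^ s) * u"
      by (simp add: c_def mult.assoc)
    also have "\<dots> = 0 \<longleftrightarrow> N * p ^ s dvd n * p ^ s"
      using assms
      by (simp only: unit_mult_eq_0_iff of_nat_mod_ring_eq_0_iff N_def flip: power_add) simp
    also have "\<dots> \<longleftrightarrow> N dvd n"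
      using p_gt_1 by (simp add: dvd_mult_cancel2)
    finally show ?thesis .
  qed
  note zero_iff = this
  have eq_iff: "of_nat i * c = of_nat j * c \<longleftrightarrow> [i = j] (mod N)" for i j
  proof (induction i j rule: linorder_wlog)
    case (le i j)
    have "of_nat i * c = of_nat j * c \<longleftrightarrow> of_nat (j - i) * c = 0"
      using le by (auto simp: of_nat_diff left_diff_distrib)
    also have "\<dots> \<longleftrightarrow> [j = i] (mod N)"
      unfolding zero_iff using cong_altdef_nat[OF le] by simp
    finally show ?case
      by (simp add: cong_sym_eq)
  next
    case (sym i j)
    then show ?case
      by (metis cong_sym_eq)
  qed
  have range: "group_closure {c} = range (\<lambda>i. of_nat i * c)"
  proof (intro equalityI subsetI)
    fix x assume "x \<in> group_closure {c}"
    then show "x \<in> range (\<lambda>i. of_nat i * c)"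
    proof induction
      case (base s)
      have "of_nat 0 * c = 0" "of_nat 1 * c = c"
        by simp_all
      then show ?case
        using base by (metis insert_iff rangeI singletonD)
    next
      case (diff s t)
      then obtain i j where st: "s = of_nat i * c" "t = of_nat j * c"
        by auto
      \<comment> \<open>Multipliers are natural numbers; as N annihilates c,
        \<open>N * j - j\<close> serves as a natural substitute for -j.\<close>
      have "of_nat (N * j - j) * c + of_nat j * c = 0"
      proof -
        have "of_nat (N * j - j) * c + of_nat j * c = of_nat (N * j - j + j) * c"
          by (simp only: of_nat_add distrib_right)
        also have "N * j - j + j = N * j"
          using N by simp
        finally show ?thesis
          unfolding zero_iff by (metis dvd_triv_left zero_iff)
      qed
      then have "of_nat (N * j - j) * c = - (of_nat j * c)"
        by (rule eq_neg_iff_add_eq_0[THEN iffD2])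
      with st have "s - t = of_nat (i + (N * j - j)) * c"
        by (simp only: of_nat_add distrib_right) simp
      then show ?case
        by blast
    qed
  next
    fix x assume "x \<in> range (\<lambda>i. of_nat i * c)"
    then show "x \<in> group_closure {c}"
      by (auto intro: group_closure_scalar_mult_left[OF group_closure.base])
  qed
  also have "\<dots> = (\<lambda>i. of_nat i * c) ` {..<N}"
  proof (intro equalityI subsetI)
    fix x assume "x \<in> range (\<lambda>i. of_nat i * c)"
    then obtain i where "x = of_nat i * c"
      by blast
    then have "x = of_nat (i mod N) * c"
      by (simp add: eq_iff)
    then show "x \<in> (\<lambda>i. of_nat i * c) ` {..<N}"
      using N by auto
  qed auto
  also have "card \<dots> = N"
    by (subst card_image) (auto simp: inj_on_def eq_iff intro: cong_less_modulus_unique_nat)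
  finally have "card (group_closure {c}) = p ^ (r - s)"
    by (simp add: N_def)
  then show ?thesis
    using p_gt_1 unfolding elem_order_def c_def by (intro the_equality) auto
qed

lemma elem_order_decomp:
  obtains u where "u dvd 1" "(c :: 'a mod_ring) = of_nat (p ^ (r - ord c)) * u" "ord c \<le> r"
proof -
  obtain s u where su: "s \<le> r" "u dvd 1" "c = of_nat (p ^ s) * u"
    using prime_power_unit_decomp .
  then have "ord c = r - s"
    using elem_order_eqI by simp
  then show thesis
    using su that[of u] by simp
qed

text \<open>Replaces the definition by cardinality: \<open>ord c\<close> is the least k such that
  \<open>p^k\<close> annihilates c. Most of the arithmetic of orders follows from this
  equivalence.\<close>

lemma pow_mult_eq_0_iff: "of_nat (p ^ k) * c = 0 \<longleftrightarrow> ord c \<le> k"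
proof -
  obtain u where u: "u dvd 1" "c = of_nat (p ^ (r - ord c)) * u" "ord c \<le> r"
    using elem_order_decomp .
  have "of_nat (p ^ k) * c = of_nat (p ^ (k + (r - ord c))) * u"
    by (subst u(2)) (simp add: power_add mult.assoc)
  also have "\<dots> = 0 \<longleftrightarrow> r \<le> k + (r - ord c)"
    using u(1) p_gt_1
    by (simp only: unit_mult_eq_0_iff of_nat_mod_ring_eq_0_iff) (simp add: dvd_power_iff)
  finally show ?thesis
    using u(3) by linarith
qed

lemma elem_order_eq_0_iff: "ord c = 0 \<longleftrightarrow> c = 0"
  using pow_mult_eq_0_iff[of 0 c] by simp

lemma elem_order_leI: "of_nat (p ^ k) * c = 0 \<Longrightarrow> ord c \<le> k"
  by (simp only: pow_mult_eq_0_iff)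

lemma elem_order_mult_le: "ord (a * c) \<le> ord c"
proof (rule elem_order_leI)
  have "of_nat (p ^ ord c) * c = 0"
    unfolding pow_mult_eq_0_iff by simp
  then show "of_nat (p ^ ord c) * (a * c) = 0"
    by (metis mult.left_commute mult_zero_right)
qed

lemma elem_order_unit_mult:
  assumes "u dvd 1"
  shows "ord (u * c) = ord c"
proof (rule antisym)
  obtain w where "u * w = 1"
    using assms by (metis dvdE)
  then have "c = w * (u * c)"
    by (simp add: mult.commute mult.left_commute)
  then show "ord c \<le> ord (u * c)"
    by (metis elem_order_mult_le)
qed (rule elem_order_mult_le)

lemma elem_order_pow_mult: "ord (of_nat (p ^ k) * c) = ord c - k"
proof -
  have "ord (of_nat (p ^ k) * c) \<le> l \<longleftrightarrow> ord c - k \<le> l" for l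
  proof -
    have "of_nat (p ^ l) * (of_nat (p ^ k) * c) = of_nat (p ^ (l + k)) * c"
      by (simp add: power_add mult.assoc)
    then have "ord (of_nat (p ^ k) * c) \<le> l \<longleftrightarrow> ord c \<le> l + k"
      by (metis pow_mult_eq_0_iff)
    then show ?thesis
      by linarith
  qed
  then show ?thesis
    by (metis le_antisym order_refl)
qed

lemma elem_order_add_le: "ord (a + b) \<le> max (ord a) (ord b)"
proof (rule elem_order_leI)
  let ?k = "max (ord a) (ord b)"
  have "of_nat (p ^ ?k) * a = 0" "of_nat (p ^ ?k) * b = 0"
    by (simp_all only: pow_mult_eq_0_iff max.cobounded1 max.cobounded2)
  then show "of_nat (p ^ ?k) * (a + b) = 0"
    by (metis add.right_neutral distrib_left)
qed

lemma elem_order_uminus: "ord (- c) = ord c"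
  using elem_order_unit_mult[of "-1" c] by simp

text \<open>The ultrametric equality: if the sum had smaller order than b, then
  \<open>b = (a + b) + (- a)\<close> would have too small an order.\<close>

lemma elem_order_add_eq:
  assumes "ord a < ord b"
  shows "ord (a + b) = ord b"
  using elem_order_add_le[of a b] elem_order_add_le[of "a + b" "- a"] assms
  by (auto simp: elem_order_uminus max_def split: if_splits)

text \<open>Both elements are powers of p times units, so divisibility is decided by the exponents
  alone; the ideals form a chain.\<close>

lemma elem_order_le_imp_dvd:
  fixes c d :: "'a mod_ring"
  assumes "ord c \<le> ord d"
  obtains t where "c = t * d"
proof -
  obtain u where u: "u dvd 1" "c = of_nat (p ^ (r - ord c)) * u" "ord c \<le> r"
    using elem_order_decomp .
  obtain v where v: "v dvd 1" "d = of_nat (p ^ (r - ord d)) * v" "ord d \<le> r"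
    using elem_order_decomp .
  obtain w where w: "v * w = 1"
    using v(1) by (metis dvdE)
  have "r - ord c = (ord d - ord c) + (r - ord d)"
    using assms u(3) v(3) by linarith
  then have "c = of_nat (p ^ (ord d - ord c)) * of_nat (p ^ (r - ord d)) * u * (v * w)"
    using u(2) w by (simp add: power_add)
  also have "\<dots> = (of_nat (p ^ (ord d - ord c)) * u * w) * (of_nat (p ^ (r - ord d)) * v)"
    by (simp only: ac_simps)
  finally show thesis
    using that v(2) by metis
qed

text \<open>Up to sign the difference is an integer from 1 to p - 1, hence prime to p. With
  \<open>e = 0\<close> this makes nonzero digits units; the general case gives uniqueness of digit
  combinations.\<close>

lemma digit_diff_dvd_1:
  fixes d e :: "'a mod_ring"
  assumes "d \<in> digits p" "e \<in> digits p" "d \<noteq> e"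
  shows "d - e dvd 1"
proof -
  have *: "(of_nat i - of_nat j :: 'a mod_ring) dvd 1" if "j < i" "i < p" for i j
  proof -
    have "\<not> p dvd i - j"
      using that by (simp add: nat_dvd_not_less)
    then show ?thesis
      using of_nat_dvd_1[of "i - j"] that by (simp add: of_nat_diff)
  qed
  obtain i j where "d = of_nat i" "e = of_nat j" "i < p" "j < p"
    using assms(1,2) by (auto simp: digits_def)
  then show ?thesis
    using *[of j i] *[of i j] assms(3) minus_dvd_iff[of "of_nat j - of_nat i :: 'a mod_ring" 1]
    by (cases i j rule: linorder_cases) auto
qed

lemma zero_in_digits: "(0 :: 'a mod_ring) \<in> digits p"
  using p_gt_1 unfolding digits_def by (intro image_eqI[of _ _ 0]) auto

lemma digit_dvd_1: "d \<in> digits p \<Longrightarrow> d \<noteq> 0 \<Longrightarrow> (d :: 'a mod_ring) dvd 1"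
  using digit_diff_dvd_1[of d 0] zero_in_digits by simp

lemma digit_decomp:
  obtains d t where "d \<in> digits p" "(c :: 'a mod_ring) = d + of_nat p * t"
proof -
  obtain n where "c = of_nat n"
    using mod_ring_eq_of_nat by blast
  then have "c = of_nat (n mod p) + of_nat p * of_nat (n div p)"
    by (metis mod_mult_div_eq of_nat_add of_nat_mult)
  moreover have "of_nat (n mod p) \<in> digits p"
    using p_gt_1 by (simp add: digits_def)
  ultimately show thesis
    using that by blast
qed

text \<open>Equal orders give \<open>c = t * d\<close>. Subtracting the last base-p digit
  \<open>e\<close> of \<open>t\<close> leaves a multiple of \<open>p * d\<close>, whose order is
  smaller. That digit is nonzero, since otherwise \<open>c\<close> itself would have this smaller
  order.\<close>

lemma digit_cancel:
  assumes "ord c = ord d" "c \<noteq> 0"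
  obtains e where "e \<in> digits p" "e \<noteq> 0" "ord (c - e * d) < ord c"
proof -
  obtain t where t: "c = t * d"
    using elem_order_le_imp_dvd assms(1) by (metis order_refl)
  obtain e s where e: "e \<in> digits p" "t = e + of_nat p * s"
    using digit_decomp .
  have "ord (of_nat p * s * d) \<le> ord d - 1"
    using elem_order_mult_le[of s "of_nat p * d"] elem_order_pow_mult[of 1 d]
    by (simp add: ac_simps)
  also have "\<dots> < ord c"
    using assms elem_order_eq_0_iff[of c] by simp
  finally have less: "ord (of_nat p * s * d) < ord c" .
  have "c - e * d = of_nat p * s * d"
    unfolding t e(2) by (simp add: algebra_simps)
  moreover have "e \<noteq> 0"
    using less t e(2) by auto
  ultimately show thesis
    using less e(1) that by metis
qed

end

section \<open>Leading data of vectors of polynomials\<close>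

lemma mon_shift_shift: "mon_shift a (mon_shift b X) = mon_shift (a + b) X"
  by (simp add: mon_shift_def)

lemma mon_shift_0 [simp]: "mon_shift 0 X = X"
  by (simp add: mon_shift_def)

lemma snd_mon_shift [simp]: "snd (mon_shift a X) = snd X"
  by (simp add: mon_shift_def)

lemma mon_coeff_0 [simp]: "mon_coeff 0 X = 0"
  by (simp add: mon_coeff_def)

lemma mon_coeff_add: "mon_coeff (f + g) X = mon_coeff f X + mon_coeff g X"
  by (simp add: mon_coeff_def)

lemma mon_coeff_diff: "mon_coeff (f - g) X = mon_coeff f X - mon_coeff g X"
  by (simp add: mon_coeff_def)

lemma mon_coeff_scale:
  "mon_coeff (a *s f) X = (\<Sum>k\<le>fst X. coeff a k * mon_coeff f (fst X - k, snd X))"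
  by (simp add: mon_coeff_def vector_scalar_mult_def coeff_mult)

lemma mon_coeff_scale_monom:
  "mon_coeff (monom c \<alpha> *s f) X =
     (if \<alpha> \<le> fst X then c * mon_coeff f (fst X - \<alpha>, snd X) else 0)"
  by (auto simp: mon_coeff_def vector_scalar_mult_def coeff_monom_mult)

lemma of_nat_eq_monom: "(of_nat n :: 'a::comm_semiring_1 poly) = monom (of_nat n) 0"
  by (simp add: of_nat_poly monom_0)

lemma mon_coeff_scale_of_nat: "mon_coeff (of_nat n *s f) X = of_nat n * mon_coeff f X"
  by (simp add: of_nat_eq_monom mon_coeff_scale_monom)

lemma mon_coeff_mon_term: "mon_coeff (mon_term c X) Y = (if X = Y then c else 0)"
  by (auto simp: mon_coeff_def mon_term_def axis_def prod_eq_iff)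

lemma monom_scale_mon_term:
  "monom t \<alpha> *s mon_term c X = mon_term (t * c) (mon_shift \<alpha> X)"
  by (simp add: vec_eq_iff mon_term_def mon_shift_def axis_def mult_monom add.commute)

lemma polyvec_eqI: "(\<And>X. mon_coeff f X = mon_coeff g X) \<Longrightarrow> f = g"
  by (auto simp: mon_coeff_def vec_eq_iff poly_eq_iff)

lemma finite_mon_support: "finite {X. mon_coeff f X \<noteq> 0}"
proof (rule finite_subset)
  show "{X. mon_coeff f X \<noteq> 0} \<subseteq> {..Max (range (\<lambda>i. degree (f $ i)))} \<times> UNIV"
  proof
    fix X assume "X \<in> {X. mon_coeff f X \<noteq> 0}"
    then have "fst X \<le> degree (f $ snd X)"
      by (simp add: mon_coeff_def le_degree)
    also have "\<dots> \<le> Max (range (\<lambda>i. degree (f $ i)))"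
      by simp
    finally show "X \<in> {..Max (range (\<lambda>i. degree (f $ i)))} \<times> UNIV"
      by (simp add: mem_Times_iff)
  qed
qed simp

section \<open>Monomial orders and leading terms of products\<close>

locale monomial_ordering =
  fixes mle :: "'q::finite monomial \<Rightarrow> 'q monomial \<Rightarrow> bool"  (infix \<open>\<preceq>\<close> 50)
  assumes monomial_order: "monomial_order mle"
begin

abbreviation mless :: "'q monomial \<Rightarrow> 'q monomial \<Rightarrow> bool"  (infix \<open>\<prec>\<close> 50) where
  "mless \<equiv> strict_part mle"

sublocale mon: linorder mle "strict_part mle"
  using monomial_order by (simp add: monomial_order_def)

lemma mless_shift: "\<gamma> > 0 \<Longrightarrow> X \<prec> mon_shift \<gamma> X"
  using monomial_order unfolding monomial_order_def One_nat_def by (meson Suc_leI)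

lemma mon_shift_strict_mono: "X \<prec> Y \<Longrightarrow> mon_shift \<gamma> X \<prec> mon_shift \<gamma> Y"
  using monomial_order unfolding monomial_order_def by meson

lemma mon_shift_less_iff: "mon_shift \<gamma> X \<prec> mon_shift \<gamma> Y \<longleftrightarrow> X \<prec> Y"
  by (metis mon.less_asym mon.neq_iff mon_shift_strict_mono mon.less_irrefl)

lemma mle_shift: "X \<preceq> mon_shift \<gamma> X"
  using mless_shift[of \<gamma> X] by (cases "\<gamma> = 0") (auto intro: mon.less_imp_le)

text \<open>Of two monomials in the same position one is a shift of the other, and shifts never
  decrease; hence all monomial orders agree within a position.\<close>

lemma same_pos_le_iff: 
  assumes "snd X = snd Y"
  shows "X \<preceq> Y \<longleftrightarrow> fst X \<le> fst Y"
proof -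
  have *: "X \<preceq> Y" if "fst X \<le> fst Y" "snd X = snd Y" for X Y
  proof -
    have "Y = mon_shift (fst Y - fst X) X"
      using that by (simp add: mon_shift_def prod_eq_iff)
    then show ?thesis
      by (metis mle_shift)
  qed
  show ?thesis
    using *[of X Y] *[of Y X] assms by (metis mon.order.antisym nle_le)
qed

text \<open>Within one position the order is that of the exponents, and there are finitely many positions.\<close>

lemma wf_mless: "wf {(X, Y). X \<prec> Y}"
proof (rule wfI_min)
  fix S :: "'q monomial set" and X
  assume "X \<in> S"
  define T where "T = (\<lambda>i. (LEAST n. (n, i) \<in> S, i)) ` snd ` S"
  have T: "finite T" "T \<noteq> {}"
    using \<open>X \<in> S\<close> by (auto simp: T_def)
  then have "mon.Min T \<in> T"
    by (rule mon.Min_in)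
  moreover have "T \<subseteq> S"
    by (auto simp: T_def intro: LeastI)
  moreover have "Y \<notin> S" if "Y \<prec> mon.Min T" for Y
  proof
    assume "Y \<in> S"
    let ?Z = "(LEAST n. (n, snd Y) \<in> S, snd Y)"
    have "?Z \<in> T"
      using \<open>Y \<in> S\<close> by (auto simp: T_def)
    then have "mon.Min T \<preceq> ?Z"
      using T by simp
    also have "?Z \<preceq> Y"
      using \<open>Y \<in> S\<close> by (subst same_pos_le_iff) (auto intro: Least_le)
    finally show False
      using that by simp
  qed
  ultimately show "\<exists>Z\<in>S. \<forall>Y. (Y, Z) \<in> {(X, Y). X \<prec> Y} \<longrightarrow> Y \<notin> S"
    by blast
qed

lemma lm_ge: "mon_coeff f X \<noteq> 0 \<Longrightarrow> X \<preceq> lm mle f"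
  unfolding lm_def by (intro mon.Max_ge finite_mon_support) simp

lemma lc_eq_0_iff [simp]: "lc mle f = 0 \<longleftrightarrow> f = 0"
proof
  show "f = 0" if "lc mle f = 0"
  proof (rule ccontr)
    assume "f \<noteq> 0"
    then have "{X. mon_coeff f X \<noteq> 0} \<noteq> {}"
      using polyvec_eqI[of f 0] by auto
    then have "mon.Max {X. mon_coeff f X \<noteq> 0} \<in> {X. mon_coeff f X \<noteq> 0}"
      by (intro mon.Max_in finite_mon_support)
    with that show False
      by (simp add: lc_def lm_def)
  qed
qed (simp add: lc_def)

lemma lm_eqI:
  assumes "mon_coeff f X \<noteq> 0" "\<And>Y. mon_coeff f Y \<noteq> 0 \<Longrightarrow> Y \<preceq> X"
  shows "lm mle f = X"
  unfolding lm_def using assms by (intro mon.Max_eqI finite_mon_support) auto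

text \<open>At or above the shifted leading monomial at most one term of the convolution survives.
  Nothing is assumed nonzero, because over a ring with zero divisors even this term may
  vanish.\<close>

lemma mon_coeff_scale_ge:
  assumes "mon_shift (degree a) (lm mle v) \<preceq> X"
  shows "mon_coeff (a *s v) X =
    (if X = mon_shift (degree a) (lm mle v) then lead_coeff a * lc mle v else 0)"
proof -
  \<comment> \<open>A nonzero coefficient squeezes X: it is at most the shift by k, which is at most
    the shift by \<open>degree a\<close>, which is at most X. So all three coincide and k is the
    degree.\<close>
  have 0: "mon_coeff v (fst X - k, snd X) = 0"
    if "k \<le> degree a" "k \<le> fst X" "k \<noteq> degree a \<or> X \<noteq> mon_shift (degree a) (lm mle v)" for k
  proof (rule ccontr)
    assume "mon_coeff v (fst X - k, snd X) \<noteq> 0"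
    then have "(fst X - k, snd X) \<preceq> lm mle v"
      by (rule lm_ge)
    then have "mon_shift k (fst X - k, snd X) \<preceq> mon_shift k (lm mle v)"
      by (metis mon.not_less mon_shift_less_iff)
    moreover have "mon_shift k (fst X - k, snd X) = X"
      using that by (simp add: mon_shift_def)
    ultimately have le: "X \<preceq> mon_shift k (lm mle v)"
      by simp
    have "mon_shift k (lm mle v) \<preceq> mon_shift (degree a) (lm mle v)"
      using that by (subst same_pos_le_iff) (auto simp: mon_shift_def)
    with le assms have "X = mon_shift k (lm mle v)" "X = mon_shift (degree a) (lm mle v)"
      by (auto intro: mon.order.antisym mon.order.trans)
    with that show False
      by (auto simp: mon_shift_def)
  qed
  show ?thesis
  proof (cases "X = mon_shift (degree a) (lm mle v)")
    case True
    then have X: "degree a \<le> fst X" "(fst X - degree a, snd X) = lm mle v"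
      by (auto simp: mon_shift_def)
    have "mon_coeff (a *s v) X =
        (\<Sum>k\<le>fst X. if k = degree a then lead_coeff a * lc mle v else 0)"
      unfolding mon_coeff_scale lc_def
    proof (rule sum.cong)
      fix k assume "k \<in> {..fst X}"
      then show "coeff a k * mon_coeff v (fst X - k, snd X) =
          (if k = degree a then lead_coeff a * mon_coeff v (lm mle v) else 0)"
        using 0[of k] X by (cases "k \<le> degree a") (auto simp: coeff_eq_0)
    qed simp
    then show ?thesis
      using True X(1) by simp
  next
    case False
    then have "coeff a k * mon_coeff v (fst X - k, snd X) = 0" if "k \<le> fst X" for k
      using 0[of k] that by (cases "k \<le> degree a") (auto simp: coeff_eq_0)
    with False show ?thesis
      by (simp add: mon_coeff_scale)
  qed
qed

lemma
  assumes "lead_coeff a * lc mle v \<noteq> 0"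
  shows lm_scale: "lm mle (a *s v) = mon_shift (degree a) (lm mle v)"
    and lc_scale: "lc mle (a *s v) = lead_coeff a * lc mle v"
proof -
  show "lm mle (a *s v) = mon_shift (degree a) (lm mle v)"
  proof (rule lm_eqI)
    show "mon_coeff (a *s v) (mon_shift (degree a) (lm mle v)) \<noteq> 0"
      using assms by (subst mon_coeff_scale_ge) auto
    show "Y \<preceq> mon_shift (degree a) (lm mle v)" if "mon_coeff (a *s v) Y \<noteq> 0" for Y
    proof (rule ccontr)
      assume "\<not> Y \<preceq> mon_shift (degree a) (lm mle v)"
      then have "mon_shift (degree a) (lm mle v) \<prec> Y"
        by simp
      then have "mon_coeff (a *s v) Y = 0"
        by (subst mon_coeff_scale_ge) auto
      with that show False
        by simp
    qed
  qed
  then show "lc mle (a *s v) = lead_coeff a * lc mle v"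
    by (simp add: lc_def mon_coeff_scale_ge[unfolded lc_def])
qed

end

section \<open>Leading keys and sums without cancellation\<close>

locale leading_keys = prime_power_mod p r R + monomial_ordering mle
  for p r and R :: "'a::nontriv itself"
    and mle :: "'q::finite monomial \<Rightarrow> 'q monomial \<Rightarrow> bool"  (infix \<open>\<preceq>\<close> 50)
begin

definition key :: "('a, 'q) polyvec \<Rightarrow> 'q monomial \<times> nat" where
  "key f = (lm mle f, vec_order mle p f)"

text \<open>Defined on arbitrary pairs, so that a key can also be compared with a bound that is not
  given as the key of a vector.\<close>

definition key_less :: "'q monomial \<times> nat \<Rightarrow> 'q monomial \<times> nat \<Rightarrow> bool"  (infix \<open>\<prec>\<^sub>k\<close> 50) where
  "K \<prec>\<^sub>k L \<longleftrightarrow> fst K \<prec> fst L \<or> fst K = fst L \<and> snd K < snd L"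

lemma key_less_trans: "K \<prec>\<^sub>k L \<Longrightarrow> L \<prec>\<^sub>k J \<Longrightarrow> K \<prec>\<^sub>k J"
  unfolding key_less_def by (metis mon.order.strict_trans order.strict_trans)

lemma key_less_irrefl [simp]: "\<not> K \<prec>\<^sub>k K"
  by (simp add: key_less_def)

lemma key_less_linear: "K \<prec>\<^sub>k L \<or> K = L \<or> L \<prec>\<^sub>k K"
  unfolding key_less_def by (metis mon.less_linear nat_neq_iff prod_eq_iff)

lemma wf_key_less: "wf {(f, g). key f \<prec>\<^sub>k key g}"
proof (rule wf_subset)
  show "wf (inv_image ({(X, Y). X \<prec> Y} <*lex*> less_than) key)"
    by (intro wf_inv_image wf_lex_prod wf_mless wf_less_than)
qed (auto simp: key_less_def inv_image_def lex_prod_def split_beta)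

lemma vec_order_eq_0_iff: "vec_order mle p f = 0 \<longleftrightarrow> (f :: ('a, 'q) polyvec) = 0"
  by (simp add: vec_order_def elem_order_eq_0_iff)

text \<open>The descent criterion after a partial cancellation at X: either X survives as leading
  monomial with smaller order, or the leading monomial itself drops.\<close>

lemma key_lessI:
  assumes "f \<noteq> 0" "\<And>Y. mon_coeff f Y \<noteq> 0 \<Longrightarrow> Y \<preceq> X" "ord (mon_coeff f X) < n"
  shows "key f \<prec>\<^sub>k (X, n)"
proof -
  have "lm mle f \<preceq> X"
    using assms(1) by (intro assms(2)) (simp flip: lc_def)
  then show ?thesis
    using assms(3) by (auto simp: key_less_def key_def vec_order_def lc_def mon.le_less)
qed

text \<open>At the leading monomial of g, the coefficient of f has smaller order than
  \<open>lc g\<close>: either both leading monomials agree and the orders decide, or that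
  coefficient is 0. So the coefficient of the sum there keeps the order of \<open>lc g\<close> and
  cannot vanish.\<close>

lemma key_add:
  assumes "f \<noteq> 0" "g \<noteq> 0" "key f \<prec>\<^sub>k key g"
  shows "f + g \<noteq> 0 \<and> key (f + g) = key g"
proof -
  have less: "ord (mon_coeff f (lm mle g)) < ord (lc mle g)"
  proof (cases "lm mle f = lm mle g")
    case True
    with assms(3) show ?thesis
      by (simp add: key_less_def key_def vec_order_def lc_def)
  next
    case False
    with assms(3) have "lm mle f \<prec> lm mle g"
      by (simp add: key_less_def key_def)
    then have "mon_coeff f (lm mle g) = 0"
      using lm_ge[of f "lm mle g"] by (metis mon.not_less)
    moreover have "ord (lc mle g) \<noteq> 0"
      using assms(2) by (simp add: elem_order_eq_0_iff)
    ultimately show ?thesis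
      using elem_order_eq_0_iff[of 0] by simp
  qed
  then have ord: "ord (mon_coeff (f + g) (lm mle g)) = ord (lc mle g)"
    by (simp add: mon_coeff_add lc_def elem_order_add_eq)
  with less have nz: "mon_coeff (f + g) (lm mle g) \<noteq> 0"
    using elem_order_eq_0_iff[of 0] by (metis not_less_zero)
  have le: "lm mle f \<preceq> lm mle g"
    using assms(3) by (auto simp: key_less_def key_def mon.le_less)
  have "lm mle (f + g) = lm mle g"
  proof (rule lm_eqI[OF nz])
    fix Y assume "mon_coeff (f + g) Y \<noteq> 0"
    then have "mon_coeff f Y \<noteq> 0 \<or> mon_coeff g Y \<noteq> 0"
      by (auto simp: mon_coeff_add)
    then show "Y \<preceq> lm mle g"
      using lm_ge[of f Y] lm_ge[of g Y] le by (auto intro: mon.order.trans)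
  qed
  with ord nz show ?thesis
    by (auto simp: key_def vec_order_def lc_def)
qed

lemma key_sum:
  assumes "finite I" "I \<noteq> {}" "\<And>i. i \<in> I \<Longrightarrow> w i \<noteq> 0" "inj_on (\<lambda>i. key (w i)) I"
  obtains m where "m \<in> I" "sum w I \<noteq> 0" "key (sum w I) = key (w m)"
    "\<And>i. i \<in> I \<Longrightarrow> \<not> key (w m) \<prec>\<^sub>k key (w i)"
proof -
  have "\<exists>m\<in>I. sum w I \<noteq> 0 \<and> key (sum w I) = key (w m) \<and> (\<forall>i\<in>I. \<not> key (w m) \<prec>\<^sub>k key (w i))"
    using assms
  proof (induction rule: finite_ne_induct)
    case (insert x F)
    then obtain m where m: "m \<in> F" "sum w F \<noteq> 0" "key (sum w F) = key (w m)"
      "\<forall>i\<in>F. \<not> key (w m) \<prec>\<^sub>k key (w i)"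
      by (auto simp: inj_on_def)
    then have "key (w x) \<noteq> key (w m)"
      using insert.prems(2) insert.hyps(3) by (auto simp: inj_on_def)
    then consider "key (w x) \<prec>\<^sub>k key (w m)" | "key (w m) \<prec>\<^sub>k key (w x)"
      using key_less_linear by blast
    then show ?case
    proof cases
      case 1
      then have "\<not> key (w m) \<prec>\<^sub>k key (w x)"
        using key_less_trans key_less_irrefl by blast
      then show ?thesis
        using key_add[of "w x" "sum w F"] 1 m insert.prems(1) insert.hyps by auto
    next
      case 2
      then have "\<forall>i\<in>F. \<not> key (w x) \<prec>\<^sub>k key (w i)"
        using m(4) key_less_trans by blast
      then show ?thesis
        using key_add[of "sum w F" "w x"] 2 m insert.prems(1) insert.hyps
        by (auto simp: add.commute)
    qed
  qed simp
  then show thesis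
    using that by blast
qed

lemma zero_in_digit_polys: "(0 :: 'a mod_ring poly) \<in> digit_polys p"
  using zero_in_digits by (simp add: digit_polys_def)

lemma
  assumes "a \<in> digit_polys p" "a \<noteq> 0" "v \<noteq> 0"
  shows digit_scale_nonzero: "a *s v \<noteq> 0"
    and key_digit_scale: "key (a *s v) = (mon_shift (degree a) (lm mle v), vec_order mle p v)"
proof -
  have unit: "lead_coeff a dvd 1"
    using assms(1,2) by (intro digit_dvd_1) (auto simp: digit_polys_def)
  then have nz: "lead_coeff a * lc mle v \<noteq> 0"
    using assms(3) by (subst mult.commute) (simp add: unit_mult_eq_0_iff)
  then have "lc mle (a *s v) \<noteq> 0"
    by (simp add: lc_scale)
  then show "a *s v \<noteq> 0"
    by simp
  show "key (a *s v) = (mon_shift (degree a) (lm mle v), vec_order mle p v)"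
    using nz unit by (simp add: key_def vec_order_def lm_scale lc_scale elem_order_unit_mult)
qed

end

section \<open>Sequences with distinct leading keys\<close>

text \<open>Isolates what is needed of the expanded sequence: \<open>orders_distinct\<close>
  prevents cancellation and so gives independence, \<open>orders_cover\<close> drives the descent
  that gives spanning, and \<open>key_decreasing\<close> confines the combination for
  \<open>p v_i\<close> to later vectors.\<close>

locale leading_p_basis = leading_keys p r R mle
  for p r and R :: "'a::nontriv itself"
    and mle :: "'q::finite monomial \<Rightarrow> 'q monomial \<Rightarrow> bool"  (infix \<open>\<preceq>\<close> 50) +
  fixes M :: "('a, 'q) polyvec set" and vs :: "('a, 'q) polyvec list"
  assumes subspace: "Modules.module.subspace (*s) M"
    and subset: "set vs \<subseteq> M"
    and nonzero: "0 \<notin> set vs"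
    and key_decreasing: "i < j \<Longrightarrow> j < length vs \<Longrightarrow> key (vs ! j) \<prec>\<^sub>k key (vs ! i)"
    and orders_distinct: "i < j \<Longrightarrow> j < length vs \<Longrightarrow> lpos mle (vs ! i) = lpos mle (vs ! j) \<Longrightarrow>
      vec_order mle p (vs ! i) \<noteq> vec_order mle p (vs ! j)"
    and orders_cover: "f \<in> M \<Longrightarrow> f \<noteq> 0 \<Longrightarrow>
      \<exists>j<length vs. \<exists>\<alpha>. lm mle f = mon_shift \<alpha> (lm mle (vs ! j)) \<and>
        vec_order mle p f = vec_order mle p (vs ! j)"
begin

lemma nth_nonzero: "j < length vs \<Longrightarrow> vs ! j \<noteq> 0"
  using nonzero by (metis nth_mem)

lemma nth_in: "j < length vs \<Longrightarrow> vs ! j \<in> M"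
  using subset by (meson nth_mem subsetD)

lemma scale_in: "f \<in> M \<Longrightarrow> a *s f \<in> M"
  by (rule module.subspace_scale[OF module_vector_scalar_mult subspace])

lemma distinct: "distinct vs"
  unfolding distinct_conv_nth
  by (metis key_decreasing key_less_irrefl linorder_neqE_nat)

lemma key_digit_comb:
  assumes digits: "\<And>j. j < length vs \<Longrightarrow> a j \<in> digit_polys p"
    and nontrivial: "\<exists>j<length vs. a j \<noteq> 0"
  obtains m where "m < length vs" "a m \<noteq> 0" "(\<Sum>j<length vs. a j *s vs ! j) \<noteq> 0"
    "key (\<Sum>j<length vs. a j *s vs ! j) =
      (mon_shift (degree (a m)) (lm mle (vs ! m)), vec_order mle p (vs ! m))"
    "\<And>j. j < length vs \<Longrightarrow> a j \<noteq> 0 \<Longrightarrow>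
      \<not> key (\<Sum>j<length vs. a j *s vs ! j) \<prec>\<^sub>k
        (mon_shift (degree (a j)) (lm mle (vs ! j)), vec_order mle p (vs ! j))"
proof -
  define I where "I = {j. j < length vs \<and> a j \<noteq> 0}"
  have key: "key (a j *s vs ! j) =
      (mon_shift (degree (a j)) (lm mle (vs ! j)), vec_order mle p (vs ! j))"
    and nz: "a j *s vs ! j \<noteq> 0" if "j \<in> I" for j
    using that digits nth_nonzero key_digit_scale[of "a j" "vs ! j"]
      digit_scale_nonzero[of "a j" "vs ! j"] by (auto simp: I_def)
  have sum: "(\<Sum>j<length vs. a j *s vs ! j) = (\<Sum>j\<in>I. a j *s vs ! j)"
    by (rule sum.mono_neutral_right) (auto simp: I_def vec_eq_iff)
  have "inj_on (\<lambda>j. key (a j *s vs ! j)) I"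
  proof (rule inj_onI, rule ccontr)
    fix i j assume ij: "i \<in> I" "j \<in> I" "key (a i *s vs ! i) = key (a j *s vs ! j)" "i \<noteq> j"
    then have "lpos mle (vs ! i) = lpos mle (vs ! j)"
      "vec_order mle p (vs ! i) = vec_order mle p (vs ! j)"
      unfolding lpos_def by (metis key prod.inject snd_mon_shift)+
    then show False
      using ij orders_distinct[of i j] orders_distinct[of j i] unfolding I_def
      by (metis (no_types, lifting) linorder_neqE_nat mem_Collect_eq)
  qed
  moreover have "finite I" "I \<noteq> {}"
    using nontrivial by (auto simp: I_def)
  ultimately obtain m where "m \<in> I" "(\<Sum>j\<in>I. a j *s vs ! j) \<noteq> 0"
    "key (\<Sum>j\<in>I. a j *s vs ! j) = key (a m *s vs ! m)"
    "\<And>j. j \<in> I \<Longrightarrow> \<not> key (a m *s vs ! m) \<prec>\<^sub>k key (a j *s vs ! j)"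
    using key_sum[of I "\<lambda>j. a j *s vs ! j"] nz by blast
  then show thesis
    using that[of m] unfolding sum by (simp add: key) (simp add: I_def key)
qed

text \<open>Mostly used backwards: a vector whose key, even before shifting, exceeds that of the sum
  must have coefficient zero.\<close>

lemma key_digit_comb_ge:
  assumes "\<forall>j<length vs. a j \<in> digit_polys p" "j < length vs" "a j \<noteq> 0"
    "f = (\<Sum>j<length vs. a j *s vs ! j)"
  shows "f \<noteq> 0"
    and "\<not> key f \<prec>\<^sub>k (mon_shift (degree (a j)) (lm mle (vs ! j)), vec_order mle p (vs ! j))"
proof -
  have "f \<noteq> 0 \<and>
    \<not> key f \<prec>\<^sub>k (mon_shift (degree (a j)) (lm mle (vs ! j)), vec_order mle p (vs ! j))"
    by (rule key_digit_comb[of a]) (use assms in auto)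
  then show "f \<noteq> 0"
    "\<not> key f \<prec>\<^sub>k (mon_shift (degree (a j)) (lm mle (vs ! j)), vec_order mle p (vs ! j))"
    by blast+
qed

lemma key_digit_comb_attained:
  assumes "\<forall>j<length vs. a j \<in> digit_polys p" "\<exists>j<length vs. a j \<noteq> 0"
    "f = (\<Sum>j<length vs. a j *s vs ! j)"
  shows "\<exists>m<length vs. a m \<noteq> 0 \<and>
    key f = (mon_shift (degree (a m)) (lm mle (vs ! m)), vec_order mle p (vs ! m))"
  by (rule key_digit_comb[of a]) (use assms in auto)

lemma p_lin_indep: "p_lin_indep p vs"
  unfolding p_lin_indep_def
proof safe
  fix a j
  assume "\<forall>j<length vs. a j \<in> digit_polys p" "(\<Sum>j<length vs. a j *s vs ! j) = 0"
    "j < length vs"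
  then show "a j = 0"
    using key_digit_comb_ge(1)[of a j] by metis
qed

lemma key_le_shift: "(X, n) = (mon_shift \<gamma> X, n) \<or> (X, n) \<prec>\<^sub>k (mon_shift \<gamma> X, n)"
  using mle_shift[of X \<gamma>] by (auto simp: key_less_def mon.le_less)

lemma digit_comb_exists:
  assumes "f \<in> M"
  shows "\<exists>a. (\<forall>j<length vs. a j \<in> digit_polys p) \<and> f = (\<Sum>j<length vs. a j *s vs ! j)"
  using wf_key_less assms
proof (induction f rule: wf_induct_rule)
  case (less f)
  have zero: "(\<Sum>j<length vs. 0 *s vs ! j) = 0"
    by (simp add: vec_eq_iff)
  show ?case
  proof (cases "f = 0")
    case True
    then show ?thesis
      using zero zero_in_digit_polys by (intro exI[of _ "\<lambda>_. 0"]) simp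
  next
    case False
    then obtain j \<alpha> where j: "j < length vs"
      and lm: "lm mle f = mon_shift \<alpha> (lm mle (vs ! j))"
      and ord: "ord (lc mle f) = ord (lc mle (vs ! j))"
      using orders_cover less.prems unfolding vec_order_def by blast
    obtain e where e: "e \<in> digits p" "e \<noteq> 0"
      and cancel: "ord (lc mle f - e * lc mle (vs ! j)) < ord (lc mle f)"
      using digit_cancel[OF ord] False by auto
    define w where "w = monom e \<alpha> *s vs ! j"
    have "lc mle (vs ! j) * e \<noteq> 0"
      using e nth_nonzero[OF j] digit_dvd_1 by (simp add: unit_mult_eq_0_iff)
    moreover have deg: "degree (monom e \<alpha>) = \<alpha>"
      using e(2) by (rule degree_monom_eq)
    ultimately have nz: "lead_coeff (monom e \<alpha>) * lc mle (vs ! j) \<noteq> 0"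
      by (simp add: mult.commute)
    have w: "lm mle w = lm mle f" "lc mle w = e * lc mle (vs ! j)"
      using lm_scale[OF nz] lc_scale[OF nz] unfolding w_def lm deg by simp_all
    have "w \<in> M"
      unfolding w_def using j by (intro scale_in nth_in)
    with less.prems have "f - w \<in> M"
      by (intro module.subspace_diff[OF module_vector_scalar_mult subspace])
    \<comment> \<open>The last conjunct strengthens the induction hypothesis: \<open>e\<close> is to
      be added to the coefficient of \<open>a j\<close> at \<alpha>, and a sum of two nonzero digits
      need not be a digit.\<close>
    have "\<exists>a. (\<forall>i<length vs. a i \<in> digit_polys p) \<and> f - w = (\<Sum>i<length vs. a i *s vs ! i) \<and>
        coeff (a j) \<alpha> = 0"
    proof (cases "f - w = 0")
      case True
      then show ?thesis
        using zero zero_in_digit_polys by (intro exI[of _ "\<lambda>_. 0"]) simp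
    next
      case False
      have less': "key (f - w) \<prec>\<^sub>k (lm mle f, ord (lc mle f))"
      proof (rule key_lessI[OF False])
        show "Y \<preceq> lm mle f" if "mon_coeff (f - w) Y \<noteq> 0" for Y
        proof -
          have "mon_coeff f Y \<noteq> 0 \<or> mon_coeff w Y \<noteq> 0"
            using that by (auto simp: mon_coeff_diff)
          then show ?thesis
            using lm_ge w(1) by metis
        qed
        show "ord (mon_coeff (f - w) (lm mle f)) < ord (lc mle f)"
          using cancel w by (simp add: mon_coeff_diff lc_def)
      qed
      then have "(f - w, f) \<in> {(f, g). key f \<prec>\<^sub>k key g}"
        by (simp add: key_def vec_order_def)
      then obtain a where a: "\<forall>i<length vs. a i \<in> digit_polys p"
        "f - w = (\<Sum>i<length vs. a i *s vs ! i)"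
        using less.IH \<open>f - w \<in> M\<close> by blast
      \<comment> \<open>Otherwise \<open>a j\<close> has degree at least \<alpha>, so its term in
        the combination has a key no smaller than that of f. But no term exceeds the key of
        \<open>f - w\<close>, which is strictly smaller.\<close>
      have "coeff (a j) \<alpha> = 0"
      proof (rule ccontr)
        assume nz: "coeff (a j) \<alpha> \<noteq> 0"
        then have "a j \<noteq> 0"
          by auto
        then have "\<not> key (f - w) \<prec>\<^sub>k
            (mon_shift (degree (a j)) (lm mle (vs ! j)), vec_order mle p (vs ! j))"
          using key_digit_comb_ge(2) a j by blast
        moreover have "mon_shift (degree (a j)) (lm mle (vs ! j)) =
            mon_shift (degree (a j) - \<alpha>) (lm mle f)"
          using le_degree[OF nz] by (simp add: lm mon_shift_shift)
        ultimately show False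
          using less' key_le_shift[of "lm mle f" "ord (lc mle f)" "degree (a j) - \<alpha>"]
          by (metis key_less_trans ord vec_order_def)
      qed
      with a show ?thesis
        by blast
    qed
    then obtain a where a: "\<forall>i<length vs. a i \<in> digit_polys p"
      "f - w = (\<Sum>i<length vs. a i *s vs ! i)" "coeff (a j) \<alpha> = 0"
      by blast
    define b where "b = a(j := a j + monom e \<alpha>)"
    have "b i \<in> digit_polys p" if "i < length vs" for i
      using a(1,3) e(1) that by (auto simp: b_def digit_polys_def)
    moreover have "f = (\<Sum>i<length vs. b i *s vs ! i)"
    proof -
      have "(\<Sum>i<length vs. b i *s vs ! i) =
          (\<Sum>i<length vs. a i *s vs ! i + (if i = j then w else 0))"
        by (rule sum.cong) (auto simp: b_def w_def vec_eq_iff algebra_simps)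
      also have "\<dots> = f - w + w"
        using j unfolding a(2) sum.distrib by simp
      finally show ?thesis
        by simp
    qed
    ultimately show ?thesis
      by blast
  qed
qed

lemma p_span: "p_span p vs = M"
proof (intro equalityI subsetI)
  fix f assume "f \<in> M"
  then show "f \<in> p_span p vs"
    using digit_comb_exists unfolding p_span_def by blast
next
  fix f assume "f \<in> p_span p vs"
  then obtain a where "f = (\<Sum>j<length vs. a j *s vs ! j)"
    unfolding p_span_def by blast
  then show "f \<in> M"
    by (auto intro!: module.subspace_sum[OF module_vector_scalar_mult subspace] scale_in nth_in)
qed

text \<open>Spanning writes \<open>p v_i\<close> as a digit combination of all vectors.
  Multiplication by p lowers the key below that of \<open>v_i\<close>, hence below that of every
  earlier vector, so the coefficients up to index i must vanish.\<close>

lemma p_multiple_in_p_span_drop: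
  assumes i: "i < length vs"
  shows "of_nat p *s vs ! i \<in> p_span p (drop (Suc i) vs)"
proof -
  define h where "h = of_nat p *s vs ! i"
  have "h \<in> M"
    unfolding h_def using i by (intro scale_in nth_in)
  then obtain a where a: "\<forall>j<length vs. a j \<in> digit_polys p"
    "h = (\<Sum>j<length vs. a j *s vs ! j)"
    using digit_comb_exists by blast
  have less: "key h \<prec>\<^sub>k key (vs ! i)" if "h \<noteq> 0"
    unfolding key_def[of "vs ! i"]
  proof (rule key_lessI[OF that])
    show "Y \<preceq> lm mle (vs ! i)" if "mon_coeff h Y \<noteq> 0" for Y
      using that unfolding h_def mon_coeff_scale_of_nat by (intro lm_ge) auto
    have "vec_order mle p (vs ! i) > 0"
      using nth_nonzero[OF i] vec_order_eq_0_iff by blast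
    then show "ord (mon_coeff h (lm mle (vs ! i))) < vec_order mle p (vs ! i)"
      using elem_order_pow_mult[of 1 "lc mle (vs ! i)"]
      by (simp add: h_def mon_coeff_scale_of_nat vec_order_def lc_def)
  qed
  have "a j = 0" if "j \<le> i" for j
  proof (rule ccontr)
    assume "a j \<noteq> 0"
    with that i a have "h \<noteq> 0" and
      1: "\<not> key h \<prec>\<^sub>k (mon_shift (degree (a j)) (lm mle (vs ! j)), vec_order mle p (vs ! j))"
      using key_digit_comb_ge[of a j] by auto
    have "key (vs ! i) = key (vs ! j) \<or> key (vs ! i) \<prec>\<^sub>k key (vs ! j)"
      using key_decreasing that i by (cases "i = j") auto
    with less[OF \<open>h \<noteq> 0\<close>] have "key h \<prec>\<^sub>k key (vs ! j)"
      using key_less_trans[of "key h" "key (vs ! i)" "key (vs ! j)"] by auto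
    with 1 show False
      using key_le_shift[of "lm mle (vs ! j)" "vec_order mle p (vs ! j)" "degree (a j)"]
      unfolding key_def[of "vs ! j"] using key_less_trans[of "key h"] by metis
  qed
  then have "h = (\<Sum>j\<in>{Suc i..<length vs}. a j *s vs ! j)"
    unfolding a(2) by (intro sum.mono_neutral_right) (auto simp: vec_eq_iff)
  also have "\<dots> = (\<Sum>j<length (drop (Suc i) vs). a (Suc i + j) *s drop (Suc i) vs ! j)"
    by (rule sum.reindex_bij_witness[of _ "\<lambda>j. Suc i + j" "\<lambda>j. j - Suc i"]) auto
  finally show ?thesis
    using a(1) unfolding h_def p_span_def by (intro CollectI exI[of _ "\<lambda>j. a (Suc i + j)"]) auto
qed

lemma p_generator_seq:
  assumes "vs \<noteq> []"
  shows "p_generator_seq p vs"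
proof -
  \<comment> \<open>Nothing follows the last vector, and the p-span of the empty list contains only
    0.\<close>
  have "of_nat p *s last vs \<in> p_span p (drop (length vs) vs)"
    using p_multiple_in_p_span_drop[of "length vs - 1"] assms by (simp add: last_conv_nth)
  then have "of_nat p *s last vs = 0"
    by (simp add: p_span_def)
  with assms show ?thesis
    unfolding p_generator_seq_def using p_multiple_in_p_span_drop by auto
qed

lemma p_PLM:
  assumes "vs \<noteq> []"
  shows "p_PLM mle p M (set vs)"
  unfolding p_PLM_def
proof (intro conjI ballI allI impI)
  show "set vs \<noteq> {}" "finite (set vs)" "set vs \<subseteq> M" "0 \<notin> set vs"
    using assms subset nonzero by auto
  fix f a
  assume "f \<in> M" and f: "f \<noteq> 0 \<and> (\<forall>v\<in>set vs. a v \<in> digit_polys p) \<and> f = (\<Sum>v\<in>set vs. a v *s v)"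
  \<comment> \<open>The PLM property indexes coefficients by vectors, the key lemmas by list
    positions; distinctness of the list reconciles them.\<close>
  have bij: "bij_betw ((!) vs) {..<length vs} (set vs)"
    using distinct by (simp add: bij_betw_nth)
  have sum: "f = (\<Sum>j<length vs. a (vs ! j) *s vs ! j)"
    using f sum.reindex_bij_betw[OF bij, of "\<lambda>v. a v *s v"] by simp
  have nontrivial: "\<exists>j<length vs. a (vs ! j) \<noteq> 0"
  proof (rule ccontr)
    assume "\<not> ?thesis"
    then have "f = 0"
      unfolding sum by (intro sum.neutral) (auto simp: vec_eq_iff)
    with f show False
      by simp
  qed
  have digits: "\<forall>j<length vs. a (vs ! j) \<in> digit_polys p"
    using f by simp
  obtain m where m: "m < length vs" "a (vs ! m) \<noteq> 0"
    "key f = (mon_shift (degree (a (vs ! m))) (lm mle (vs ! m)), vec_order mle p (vs ! m))"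
    using key_digit_comb_attained[OF digits nontrivial sum] by blast
  let ?A = "{mon_shift (degree (a v)) (lm mle v) |v. v \<in> set vs \<and> a v \<noteq> 0}"
  have "mon.Max ?A = lm mle f"
  proof (rule mon.Max_eqI)
    show "finite ?A"
      by (rule finite_subset[of _ "(\<lambda>v. mon_shift (degree (a v)) (lm mle v)) ` set vs"]) auto
    show "Y \<preceq> lm mle f" if Y: "Y \<in> ?A" for Y
    proof -
      obtain v where v: "v \<in> set vs" "a v \<noteq> 0" "Y = mon_shift (degree (a v)) (lm mle v)"
        using Y by auto
      then obtain j where j: "j < length vs" "vs ! j = v"
        by (meson in_set_conv_nth)
      then show ?thesis
        using key_digit_comb_ge(2)[OF digits _ _ sum, of j] v j by (simp add: key_less_def key_def mon.not_less)
    qed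
    show "lm mle f \<in> ?A"
      using m by (auto simp: key_def)
  qed
  then show "lm mle f = mon.Max ?A"
    by simp
qed

lemma p_basis: "vs \<noteq> [] \<Longrightarrow> p_basis p M vs"
  unfolding p_basis_def using p_generator_seq p_span p_lin_indep by blast

end

section \<open>Invariance of the \<open>p\<close>-dimension\<close>

text \<open>Coefficient lists rather than functions on indices: they allow induction along the
  generators, and restricted to finitely many values they can be counted.\<close>

definition lin_comb :: "'b::comm_ring_1 list \<Rightarrow> ('b ^ 'n) list \<Rightarrow> 'b ^ 'n::finite" where
  "lin_comb as vs = (\<Sum>j<length vs. as ! j *s vs ! j)"

lemma lin_comb_Nil [simp]: "lin_comb as [] = 0"
  by (simp add: lin_comb_def)

lemma lin_comb_Cons [simp]: "lin_comb (a # as) (v # vs) = a *s v + lin_comb as vs"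
  by (simp add: lin_comb_def sum.lessThan_Suc_shift del: sum.lessThan_Suc)

lemma lin_comb_add:
  "length as = length vs \<Longrightarrow> length bs = length vs \<Longrightarrow>
    lin_comb as vs + lin_comb bs vs = lin_comb (map2 (+) as bs) vs"
  by (simp add: lin_comb_def vec_eq_iff algebra_simps flip: sum.distrib)

lemma lin_comb_diff:
  "length as = length vs \<Longrightarrow> length bs = length vs \<Longrightarrow>
    lin_comb as vs - lin_comb bs vs = lin_comb (map2 (-) as bs) vs"
  by (simp add: lin_comb_def vec_eq_iff algebra_simps flip: sum_subtractf)

lemma lin_comb_scale:
  "length as = length vs \<Longrightarrow> t *s lin_comb as vs = lin_comb (map ((*) t) as) vs"
  by (simp add: lin_comb_def vec_eq_iff sum_distrib_left mult.assoc)

lemma lin_comb_nth: "lin_comb (map a [0..<length vs]) vs = (\<Sum>j<length vs. a j *s vs ! j)"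
  by (simp add: lin_comb_def)

lemma p_span_eq_lin_comb:
  "p_span p vs = {lin_comb as vs |as. length as = length vs \<and> set as \<subseteq> digit_polys p}"
proof (intro equalityI subsetI)
  fix f assume "f \<in> p_span p vs"
  then obtain a where a: "f = lin_comb (map a [0..<length vs]) vs" "\<forall>j<length vs. a j \<in> digit_polys p"
    unfolding p_span_def lin_comb_nth by blast
  then show "f \<in> {lin_comb as vs |as. length as = length vs \<and> set as \<subseteq> digit_polys p}"
    by (intro CollectI exI[of _ "map a [0..<length vs]"]) auto
next
  fix f assume "f \<in> {lin_comb as vs |as. length as = length vs \<and> set as \<subseteq> digit_polys p}"
  then obtain as where "f = lin_comb as vs" "length as = length vs" "set as \<subseteq> digit_polys p"
    by blast
  then show "f \<in> p_span p vs"
    unfolding p_span_def lin_comb_def by (intro CollectI exI[of _ "(!) as"]) auto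
qed

lemma p_lin_indep_iff_lin_comb:
  "p_lin_indep p vs \<longleftrightarrow>
     (\<forall>as. length as = length vs \<and> set as \<subseteq> digit_polys p \<and> lin_comb as vs = 0 \<longrightarrow> set as \<subseteq> {0})"
proof safe
  fix as x
  assume *: "p_lin_indep p vs" "length as = length vs" "set as \<subseteq> digit_polys p"
    "lin_comb as vs = 0" "x \<in> set as"
  then obtain j where "j < length vs" "x = as ! j"
    by (metis in_set_conv_nth)
  moreover have "\<forall>j<length vs. as ! j \<in> digit_polys p"
    using * by auto
  ultimately show "x = 0"
    using *(1,4) unfolding p_lin_indep_def lin_comb_def by (metis (no_types))
next
  assume *: "\<forall>as. length as = length vs \<and> set as \<subseteq> digit_polys p \<and> lin_comb as vs = 0 \<longrightarrow>
    set as \<subseteq> {0}"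
  show "p_lin_indep p vs"
    unfolding p_lin_indep_def
  proof safe
    fix a j
    assume "\<forall>j<length vs. a j \<in> digit_polys p" "(\<Sum>j<length vs. a j *s vs ! j) = 0" "j < length vs"
    moreover from this have "set (map a [0..<length vs]) \<subseteq> {0}"
      by (intro *[rule_format]) (auto simp: lin_comb_nth)
    ultimately show "a j = 0"
      by (simp add: image_subset_iff)
  qed
qed

text \<open>The disjunct \<open>vs = []\<close> is the base case of later inductions: the empty list
  is not a generator sequence, and for a single vector the span condition says that
  \<open>p v = 0\<close>.\<close>

lemma p_generator_seq_Cons:
  "p_generator_seq p (v # vs) \<longleftrightarrow>
    of_nat p *s v \<in> p_span p vs \<and> (vs = [] \<or> p_generator_seq p vs)"
proof (cases "vs = []")
  case True
  then show ?thesis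
    by (simp add: p_generator_seq_def p_span_def)
next
  case False
  have "(\<forall>i. Suc i < length (v # vs) \<longrightarrow>
        of_nat p *s (v # vs) ! i \<in> p_span p (drop (Suc i) (v # vs))) \<longleftrightarrow>
      of_nat p *s v \<in> p_span p vs \<and>
      (\<forall>i. Suc i < length vs \<longrightarrow> of_nat p *s vs ! i \<in> p_span p (drop (Suc i) vs))"
    (is "(\<forall>i. ?P i) \<longleftrightarrow> _")
  proof -
    have "(\<forall>i. ?P i) \<longleftrightarrow> ?P 0 \<and> (\<forall>i. ?P (Suc i))"
      by (metis not0_implies_Suc)
    then show ?thesis
      using False by simp
  qed
  then show ?thesis
    using False unfolding p_generator_seq_def by auto
qed

lemma in_set_map2D: "x \<in> set (map2 f as bs) \<Longrightarrow> \<exists>a\<in>set as. \<exists>b\<in>set bs. x = f a b"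
  by (force dest: set_zip_leftD set_zip_rightD)

text \<open>A strict bound on exponents leaves exactly d free coefficients, and d = 0 leaves only
  the zero polynomial.\<close>

definition polys_below :: "nat \<Rightarrow> 'b::zero poly set" where
  "polys_below d = {a. \<forall>n\<ge>d. coeff a n = 0}"

lemma polys_below_mono: "d \<le> e \<Longrightarrow> polys_below d \<subseteq> polys_below e"
  by (auto simp: polys_below_def)

lemma polys_below_add: "a \<in> polys_below d \<Longrightarrow> b \<in> polys_below d \<Longrightarrow> a + b \<in> polys_below d"
  for a :: "'b::comm_ring_1 poly"
  by (simp add: polys_below_def)

lemma polys_below_mult:
  fixes a b :: "'b::comm_ring_1 poly"
  assumes "a \<in> polys_below d" "b \<in> polys_below e"
  shows "a * b \<in> polys_below (d + e)"
  unfolding polys_below_def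
proof (intro CollectI allI impI)
  fix n assume n: "d + e \<le> n"
  show "coeff (a * b) n = 0"
    unfolding coeff_mult
  proof (intro sum.neutral ballI)
    fix i assume "i \<in> {..n}"
    then have "i \<ge> d \<or> n - i \<ge> e"
      using n by auto
    then show "coeff a i * coeff b (n - i) = 0"
      using assms by (auto simp: polys_below_def)
  qed
qed

lemma finite_polys_below:
  assumes "finite A"
  obtains d where "A \<subseteq> polys_below d"
proof -
  have "a \<in> polys_below (Suc (Max (insert 0 (degree ` A))))" if "a \<in> A" for a
  proof -
    have "degree a \<le> Max (insert 0 (degree ` A))"
      using that assms by (intro Max_ge) auto
    then show ?thesis
      by (auto simp: polys_below_def intro!: coeff_eq_0)
  qed
  then show thesis
    using that by blast
qed

text \<open>Fixed expressions of the finitely many \<open>ws\<close> through \<open>vs\<close> have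
  coefficients of bounded degree. That \<open>C\<close> is chosen before \<open>d\<close> and
  \<open>as\<close> is what the counting argument needs.\<close>

lemma lin_comb_of_span:
  fixes ws :: "('b::comm_ring_1 poly ^ 'n::finite) list"
  assumes "\<And>w. w \<in> set ws \<Longrightarrow> \<exists>cs. length cs = length vs \<and> w = lin_comb cs vs"
  shows "\<exists>C. \<forall>d as. length as = length ws \<and> set as \<subseteq> polys_below d \<longrightarrow>
    (\<exists>bs. length bs = length vs \<and> set bs \<subseteq> polys_below (d + C) \<and> lin_comb as ws = lin_comb bs vs)"
  using assms
proof (induction ws)
  case Nil
  have "lin_comb (replicate (length vs) 0) vs = 0"
    by (simp add: lin_comb_def vec_eq_iff)
  moreover have "set (replicate (length vs) (0 :: 'b poly)) \<subseteq> polys_below d" for d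
    by (auto simp: polys_below_def)
  ultimately show ?case
    by (metis length_replicate lin_comb_Nil)
next
  case (Cons w ws)
  obtain C where C: "\<And>d as. length as = length ws \<Longrightarrow> set as \<subseteq> polys_below d \<Longrightarrow>
      \<exists>bs. length bs = length vs \<and> set bs \<subseteq> polys_below (d + C) \<and> lin_comb as ws = lin_comb bs vs"
    using Cons.IH Cons.prems by (metis list.set_intros(2))
  obtain cs where cs: "length cs = length vs" "w = lin_comb cs vs"
    using Cons.prems by auto
  obtain D where D: "set cs \<subseteq> polys_below D"
    by (rule finite_polys_below[OF finite_set])
  have "\<exists>bs. length bs = length vs \<and> set bs \<subseteq> polys_below (d + max C D) \<and>
      lin_comb as (w # ws) = lin_comb bs vs"
    if as: "length as = length (w # ws)" "set as \<subseteq> polys_below d" for as d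
  proof -
    obtain a as' where a: "as = a # as'"
      using as(1) by (cases as) auto
    then obtain bs where bs: "length bs = length vs" "set bs \<subseteq> polys_below (d + C)"
      "lin_comb as' ws = lin_comb bs vs"
      using C[of as' d] as by auto
    have "lin_comb as (w # ws) = lin_comb (map2 (+) (map ((*) a) cs) bs) vs"
      using a bs cs by (simp add: lin_comb_scale lin_comb_add)
    moreover have "set (map2 (+) (map ((*) a) cs) bs) \<subseteq> polys_below (d + max C D)"
    proof
      fix x assume "x \<in> set (map2 (+) (map ((*) a) cs) bs)"
      from in_set_map2D[OF this] obtain y z where x: "y \<in> set cs" "z \<in> set bs" "x = a * y + z"
        by auto
      moreover have "a \<in> polys_below d"
        using as a by simp
      ultimately have "a * y \<in> polys_below (d + D)" "z \<in> polys_below (d + C)"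
        using D bs(2) by (auto intro: polys_below_mult)
      then show "x \<in> polys_below (d + max C D)"
        unfolding x(3)
        by (meson add_left_mono in_mono max.cobounded1 max.cobounded2 polys_below_add
            polys_below_mono)
    qed
    ultimately show ?thesis
      using bs(1) cs(1) by (intro exI[of _ "map2 (+) (map ((*) a) cs) bs"]) auto
  qed
  then show ?case
    by blast
qed

section \<open>Carries, uniqueness of digit combinations, and counting\<close>

context prime_power_mod
begin

lemma digit_poly_decomp:
  fixes a :: "'a mod_ring poly"
  assumes "a \<in> polys_below d"
  obtains e t where "e \<in> digit_polys p" "e \<in> polys_below d" "t \<in> polys_below d"
    "a = e + of_nat p * t"
proof -
  \<comment> \<open>Both choice functions must send 0 to 0: only then does \<open>map_poly\<close>
    act on every coefficient and keep the degree bound.\<close>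
  have "\<exists>f g. \<forall>c::'a mod_ring. f c \<in> digits p \<and> c = f c + of_nat p * g c \<and> (c = 0 \<longrightarrow> f c = 0 \<and> g c = 0)"
  proof -
    have "\<exists>e t. e \<in> digits p \<and> c = e + of_nat p * t \<and> (c = 0 \<longrightarrow> e = 0 \<and> t = 0)"
      for c :: "'a mod_ring"
    proof (cases "c = 0")
      case True
      then show ?thesis
        using zero_in_digits by (intro exI[of _ 0]) auto
    next
      case False
      then show ?thesis
        using digit_decomp[of c] by metis
    qed
    then show ?thesis
      by metis
  qed
  then obtain f g where fg: "\<And>c::'a mod_ring. f c \<in> digits p" "\<And>c. c = f c + of_nat p * g c"
    "f 0 = 0" "g 0 = 0"
    by metis
  show thesis
  proof
    show "map_poly f a \<in> digit_polys p"
      using fg by (simp add: digit_polys_def coeff_map_poly)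
    show "map_poly f a \<in> polys_below d" "map_poly g a \<in> polys_below d"
      using fg(3,4) assms by (simp_all add: polys_below_def coeff_map_poly)
    show "a = map_poly f a + of_nat p * map_poly g a"
      by (rule poly_eqI) (use fg in \<open>simp add: coeff_map_poly of_nat_poly\<close>)
  qed
qed

text \<open>Carries are moved to later generators, so they raise degrees only by a bounded amount.\<close>

lemma lin_comb_digits:
  fixes vs :: "('a, 'n::finite) polyvec list"
  assumes "vs = [] \<or> p_generator_seq p vs"
  shows "\<exists>C. \<forall>d as. length as = length vs \<and> set as \<subseteq> polys_below d \<longrightarrow>
    (\<exists>bs. length bs = length vs \<and> set bs \<subseteq> digit_polys p \<inter> polys_below (d + C) \<and>
      lin_comb as vs = lin_comb bs vs)"
  using assms
proof (induction vs)
  case Nil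
  show ?case
    by (rule exI[of _ 0]) auto
next
  case (Cons v vs)
  then have "of_nat p *s v \<in> p_span p vs" and gen: "vs = [] \<or> p_generator_seq p vs"
    by (simp_all add: p_generator_seq_Cons)
  then obtain cs where cs: "length cs = length vs" "of_nat p *s v = lin_comb cs vs"
    unfolding p_span_eq_lin_comb by blast
  obtain D where D: "set cs \<subseteq> polys_below D"
    by (rule finite_polys_below[OF finite_set])
  obtain C where C: "\<And>d as. length as = length vs \<Longrightarrow> set as \<subseteq> polys_below d \<Longrightarrow>
      \<exists>bs. length bs = length vs \<and> set bs \<subseteq> digit_polys p \<inter> polys_below (d + C) \<and>
        lin_comb as vs = lin_comb bs vs"
    using Cons.IH[OF gen] by metis
  \<comment> \<open>\<open>D\<close> pays for multiplying the carry \<open>t\<close> by the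
    coefficients that express \<open>p v\<close> in the later vectors, \<open>C\<close> for turning
    the resulting tail into digits.\<close>
  have "\<exists>bs. length bs = length (v # vs) \<and> set bs \<subseteq> digit_polys p \<inter> polys_below (d + (D + C)) \<and>
      lin_comb as (v # vs) = lin_comb bs (v # vs)"
    if as: "length as = length (v # vs)" "set as \<subseteq> polys_below d" for as d
  proof -
    obtain a as' where a: "as = a # as'"
      using as(1) by (cases as) auto
    then have "a \<in> polys_below d"
      using as by simp
    then obtain e t where et: "e \<in> digit_polys p" "e \<in> polys_below d" "t \<in> polys_below d"
      "a = e + of_nat p * t"
      by (rule digit_poly_decomp)
    have as': "length as' = length vs" "set as' \<subseteq> polys_below d"
      using as a by auto
    have "a *s v = e *s v + t *s (of_nat p *s v)"
      unfolding et(4) by (simp add: vec_eq_iff algebra_simps)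
    then have eq: "lin_comb as (v # vs) = e *s v + lin_comb (map2 (+) (map ((*) t) cs) as') vs"
      using a cs as' by (simp add: lin_comb_scale flip: lin_comb_add)
    have "set (map2 (+) (map ((*) t) cs) as') \<subseteq> polys_below (d + D)"
    proof
      fix x assume "x \<in> set (map2 (+) (map ((*) t) cs) as')"
      from in_set_map2D[OF this] obtain y z where "y \<in> set cs" "z \<in> set as'" "x = t * y + z"
        by auto
      moreover from this have "z \<in> polys_below (d + D)"
        using as'(2) polys_below_mono[of d "d + D"] by auto
      ultimately show "x \<in> polys_below (d + D)"
        using D et(3) by (auto intro!: polys_below_add polys_below_mult)
    qed
    then obtain bs where "length bs = length vs"
      "set bs \<subseteq> digit_polys p \<inter> polys_below (d + D + C)"
      "lin_comb (map2 (+) (map ((*) t) cs) as') vs = lin_comb bs vs"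
      using C[of "map2 (+) (map ((*) t) cs) as'" "d + D"] cs(1) as'(1) by auto
    moreover have "e \<in> polys_below (d + (D + C))"
      using et(2) polys_below_mono[of d "d + (D + C)"] by auto
    ultimately show ?thesis
      using eq et(1) by (intro exI[of _ "e # bs"]) (auto simp: add.assoc)
  qed
  then show ?case
    by blast
qed

text \<open>1 has the largest order and that order is positive, whereas a multiple of p has order at
  least one below the maximum.\<close>

lemma p_multiple_not_unit: "\<not> of_nat p * (t :: 'a mod_ring) dvd 1"
proof
  assume "of_nat p * t dvd 1"
  then obtain w where w: "1 = of_nat p * t * w"
    by (metis dvdE)
  have ord_1: "ord 1 = r"
    using elem_order_eqI[of 0 1] by simp
  moreover have "ord 1 \<noteq> 0"
    by (simp add: elem_order_eq_0_iff)
  moreover have "ord 1 = ord (t * w) - 1"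
    using elem_order_pow_mult[of 1 "t * w"] w by (simp add: mult.assoc)
  moreover have "ord (t * w) \<le> ord 1"
    using elem_order_mult_le[of "t * w" 1] by simp
  ultimately show False
    by linarith
qed

text \<open>Independence speaks only of digit combinations equal to zero, and a difference of two
  digit lists is not a digit list. The generator property turns this difference back into digits
  without losing a nonzero head; equal heads reduce the claim to the tails.\<close>

lemma lin_comb_digits_inj:
  fixes vs :: "('a, 'n::finite) polyvec list"
  assumes "vs = [] \<or> p_generator_seq p vs" "p_lin_indep p vs"
    and "length as = length vs" "length bs = length vs"
    and "set as \<subseteq> digit_polys p" "set bs \<subseteq> digit_polys p"
    and "lin_comb as vs = lin_comb bs vs"
  shows "as = bs"
  using assms
proof (induction vs arbitrary: as bs)
  case Nil
  then show ?case
    by simp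
next
  case (Cons v vs)
  obtain a as' b bs' where ab: "as = a # as'" "bs = b # bs'"
    using Cons.prems(3,4) by (cases as; cases bs) auto
  have "of_nat p *s v \<in> p_span p vs" and gen: "vs = [] \<or> p_generator_seq p vs"
    using Cons.prems(1) by (simp_all add: p_generator_seq_Cons)
  then obtain cs where cs: "length cs = length vs" "of_nat p *s v = lin_comb cs vs"
    unfolding p_span_eq_lin_comb by blast
  have indep: "e = 0 \<and> set es \<subseteq> {0}"
    if "e \<in> digit_polys p" "length es = length vs" "set es \<subseteq> digit_polys p"
      "e *s v + lin_comb es vs = 0" for e es
    using Cons.prems(2)[unfolded p_lin_indep_iff_lin_comb, rule_format, of "e # es"] that by simp
  have "p_lin_indep p vs"
    unfolding p_lin_indep_iff_lin_comb
  proof safe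
    fix es x
    assume "length es = length vs" "set es \<subseteq> digit_polys p" "lin_comb es vs = 0" "x \<in> set es"
    moreover have "0 *s v = 0" "(0 :: 'a mod_ring poly) \<in> digit_polys p"
      using zero_in_digits by (simp_all add: vec_eq_iff digit_polys_def)
    ultimately show "x = 0"
      using indep[of 0 es] by auto
  qed
  have "a = b"
  proof (rule ccontr)
    assume "a \<noteq> b"
    have "finite {a - b}"
      by simp
    then obtain d where "{a - b} \<subseteq> polys_below d"
      by (rule finite_polys_below)
    then have "a - b \<in> polys_below d"
      by simp
    then obtain e t where et: "e \<in> digit_polys p" "a - b = e + of_nat p * t"
      by (rule digit_poly_decomp)
    \<comment> \<open>With \<open>e = 0\<close> every coefficient of \<open>a - b\<close> would be a
      multiple of p, but where a and b differ their digits differ by a unit.\<close>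
    have "e \<noteq> 0"
    proof
      assume "e = 0"
      obtain n where n: "coeff a n \<noteq> coeff b n"
        using \<open>a \<noteq> b\<close> by (auto simp: poly_eq_iff)
      moreover have "coeff a n \<in> digits p" "coeff b n \<in> digits p"
        using Cons.prems(5,6) ab by (auto simp: digit_polys_def)
      ultimately have "coeff (a - b) n dvd 1"
        using digit_diff_dvd_1 by simp
      moreover have "coeff (a - b) n = of_nat p * coeff t n"
        using et(2) \<open>e = 0\<close> by (simp add: of_nat_poly)
      ultimately show False
        using p_multiple_not_unit by metis
    qed
    \<comment> \<open>The tail of the difference together with the carry \<open>t\<close> from the
      head, rewritten through the later vectors. Its entries are arbitrary polynomials and are
      reduced to digits below.\<close>
    let ?cs = "map2 (+) (map ((*) t) cs) (map2 (-) as' bs')"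
    have len: "length as' = length vs" "length bs' = length vs"
      using Cons.prems ab by auto
    have "(a - b) *s v + (lin_comb as' vs - lin_comb bs' vs) = 0"
      using Cons.prems(7) ab by (simp add: vec_eq_iff algebra_simps)
    moreover have "(a - b) *s v = e *s v + t *s (of_nat p *s v)"
      unfolding et(2) by (simp add: vec_eq_iff algebra_simps)
    moreover have "t *s (of_nat p *s v) + (lin_comb as' vs - lin_comb bs' vs) = lin_comb ?cs vs"
      using cs len by (simp add: lin_comb_scale lin_comb_diff lin_comb_add)
    ultimately have 0: "e *s v + lin_comb ?cs vs = 0"
      by (simp add: add.assoc)
    obtain d where d: "set ?cs \<subseteq> polys_below d"
      by (rule finite_polys_below[OF finite_set])
    obtain C where C: "\<forall>d as. length as = length vs \<and> set as \<subseteq> polys_below d \<longrightarrow>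
        (\<exists>bs. length bs = length vs \<and> set bs \<subseteq> digit_polys p \<inter> polys_below (d + C) \<and>
          lin_comb as vs = lin_comb bs vs)"
      using lin_comb_digits[OF gen] by blast
    have "length ?cs = length vs"
      using cs len by simp
    then obtain es where "length es = length vs" "set es \<subseteq> digit_polys p"
      "lin_comb ?cs vs = lin_comb es vs"
      using C[rule_format, of ?cs d] d by blast
    then show False
      using indep[of e es] et(1) 0 \<open>e \<noteq> 0\<close> by simp
  qed
  moreover have "as' = bs'"
    using Cons.IH[OF gen \<open>p_lin_indep p vs\<close>] Cons.prems ab \<open>a = b\<close> by simp
  ultimately show ?case
    using ab by simp
qed

lemma card_digits: "card (digits p :: 'a mod_ring set) = p"
proof -
  have "i = j" if "i < p" "j < p" "(of_nat i :: 'a mod_ring) = of_nat j" for i j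
  proof -
    have "r \<noteq> 0"
      using card nontriv[where 'a = 'a] by (metis less_irrefl power_0)
    then have "p \<le> p ^ r"
      using p_gt_1 by (simp add: self_le_power)
    moreover have "[i = j] (mod p ^ r)"
      using that(3) by (simp add: of_nat_eq_iff_cong_CHAR card)
    ultimately show ?thesis
      using that(1,2) cong_less_modulus_unique_nat[of i j "p ^ r"] by auto
  qed
  then have "inj_on (of_nat :: nat \<Rightarrow> 'a mod_ring) {0..<p}"
    by (auto intro: inj_onI)
  then show ?thesis
    by (simp add: digits_def card_image)
qed

lemma card_digit_polys_below:
  "finite (digit_polys p \<inter> polys_below d :: 'a mod_ring poly set) \<and>
   card (digit_polys p \<inter> polys_below d :: 'a mod_ring poly set) = p ^ d"
proof -
  let ?A = "digit_polys p \<inter> polys_below d :: 'a mod_ring poly set"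
  let ?B = "{xs :: 'a mod_ring list. set xs \<subseteq> digits p \<and> length xs = d}"
  have bij: "bij_betw (\<lambda>a. map (coeff a) [0..<d]) ?A ?B"
  proof (rule bij_betwI[of _ _ _ Poly])
    show "(\<lambda>a. map (coeff a) [0..<d]) \<in> ?A \<rightarrow> ?B"
      by (auto simp: digit_polys_def)
    show "Poly \<in> ?B \<rightarrow> ?A"
      using zero_in_digits
      by (auto simp: digit_polys_def polys_below_def coeff_Poly_eq nth_default_def
          intro: subsetD[OF _ nth_mem])
    show "Poly (map (coeff a) [0..<d]) = a" if "a \<in> ?A" for a
      using that by (auto simp: poly_eq_iff coeff_Poly_eq nth_default_def polys_below_def)
    show "map (coeff (Poly xs)) [0..<d] = xs" if "xs \<in> ?B" for xs
      using that by (auto simp: coeff_Poly_eq nth_default_def intro: nth_equalityI)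
  qed
  have "finite (digits p :: 'a mod_ring set)"
    by (simp add: digits_def)
  then have "finite ?B" "card ?B = p ^ d"
    by (simp_all add: card_lists_length_eq finite_lists_length_eq card_digits)
  then show ?thesis
    using bij_betw_same_card[OF bij] bij_betw_finite[OF bij] by simp
qed

text \<open>
  Combinations of \<open>ws\<close> with digit coefficients of degree below \<open>d\<close> give \<open>p\<^bsup>dn\<^esup>\<close> vectors, which are
  among the at most \<open>p\<^bsup>(d + C)N\<^esup>\<close> combinations of \<open>vs\<close> of degree below \<open>d + C\<close>; let \<open>d\<close> grow.
\<close>

lemma p_basis_length_le:
  fixes vs ws :: "('a, 'n::finite) polyvec list"
  assumes vs: "p_basis p M vs" and ws: "p_basis p M ws"
  shows "length ws \<le> length vs"
proof (rule ccontr)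
  let ?n = "length ws" and ?N = "length vs"
  assume "\<not> ?n \<le> ?N"
  have gen: "vs = [] \<or> p_generator_seq p vs" "ws = [] \<or> p_generator_seq p ws"
    using vs ws by (auto simp: p_basis_def)
  have "w \<in> p_span p vs" if "w \<in> set ws" for w
  proof -
    have "w \<in> p_span p ws"
    proof -
      obtain j where j: "j < ?n" "ws ! j = w"
        using \<open>w \<in> set ws\<close> by (meson in_set_conv_nth)
      have "(1 :: 'a mod_ring) \<in> digits p"
        using p_gt_1 unfolding digits_def by (intro image_eqI[of _ _ 1]) auto
      moreover have "w = (\<Sum>i<?n. (if i = j then 1 else 0) *s ws ! i)"
      proof -
        have "(\<Sum>i<?n. (if i = j then 1 else 0) *s ws ! i) = (\<Sum>i<?n. if i = j then ws ! i else 0)"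
          by (rule sum.cong) (auto simp: vec_eq_iff)
        with j show ?thesis
          by simp
      qed
      ultimately show ?thesis
        using zero_in_digits unfolding p_span_def
        by (intro CollectI exI[of _ "\<lambda>i. if i = j then 1 else 0"])
          (auto simp: digit_polys_def coeff_1 split: if_splits)
    qed
    then show ?thesis
      using vs ws by (simp add: p_basis_def)
  qed
  then have "\<exists>cs. length cs = length vs \<and> w = lin_comb cs vs" if "w \<in> set ws" for w
    using that unfolding p_span_eq_lin_comb by blast
  from lin_comb_of_span[OF this] obtain C where
    C: "\<And>d as. length as = ?n \<Longrightarrow> set as \<subseteq> polys_below d \<Longrightarrow>
      \<exists>bs. length bs = ?N \<and> set bs \<subseteq> polys_below (d + C) \<and> lin_comb as ws = lin_comb bs vs"
    by metis
  obtain D where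
    D: "\<And>d as. length as = ?N \<Longrightarrow> set as \<subseteq> polys_below d \<Longrightarrow>
      \<exists>bs. length bs = ?N \<and> set bs \<subseteq> digit_polys p \<inter> polys_below (d + D) \<and>
        lin_comb as vs = lin_comb bs vs"
    using lin_comb_digits[OF gen(1)] by metis
  \<comment> \<open>Just large enough that \<open>(d + C + D) * N < d * (N + 1)\<close>, so the
    constant loss in degree stays below the gain from one additional generator.\<close>
  define d where "d = Suc ((C + D) * ?N)"
  let ?P = "\<lambda>d. digit_polys p \<inter> polys_below d :: 'a mod_ring poly set"
  let ?L = "\<lambda>d n. {xs. set xs \<subseteq> ?P d \<and> length xs = n}"
  have card: "card (?L d n) = (p ^ d) ^ n" and fin: "finite (?L d n)" for d n
    using card_lists_length_eq[of "?P d" n] finite_lists_length_eq[of "?P d" n]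
      card_digit_polys_below[of d] by simp_all
  have "inj_on (\<lambda>as. lin_comb as ws) (?L d ?n)"
    using lin_comb_digits_inj[OF gen(2)] ws by (auto simp: p_basis_def inj_on_def)
  moreover have "(\<lambda>as. lin_comb as ws) ` ?L d ?n \<subseteq> (\<lambda>bs. lin_comb bs vs) ` ?L (d + C + D) ?N"
  proof safe
    fix as assume "set as \<subseteq> ?P d" "length as = ?n"
    then obtain bs where bs: "length bs = ?N" "set bs \<subseteq> polys_below (d + C)"
      "lin_comb as ws = lin_comb bs vs"
      using C[of as d] by auto
    obtain bs' where "length bs' = ?N" "set bs' \<subseteq> ?P (d + C + D)"
      "lin_comb bs vs = lin_comb bs' vs"
      using D[OF bs(1,2)] by blast
    with bs(3) show "lin_comb as ws \<in> (\<lambda>bs. lin_comb bs vs) ` ?L (d + C + D) ?N"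
      by auto
  qed
  ultimately have "card (?L d ?n) \<le> card ((\<lambda>bs. lin_comb bs vs) ` ?L (d + C + D) ?N)"
    by (intro card_inj_on_le finite_imageI fin)
  also have "\<dots> \<le> card (?L (d + C + D) ?N)"
    by (intro card_image_le fin)
  finally have "card (?L d ?n) \<le> card (?L (d + C + D) ?N)" .
  then have "p ^ (d * ?n) \<le> p ^ ((d + C + D) * ?N)"
    by (simp only: card power_mult)
  then have "d * ?n \<le> (d + C + D) * ?N"
    using p_gt_1 by simp
  also have "\<dots> < d * ?N + d"
    by (simp add: d_def algebra_simps)
  also have "d * ?N + d = d * Suc ?N"
    by simp
  also have "\<dots> \<le> d * ?n"
    using \<open>\<not> ?n \<le> ?N\<close> by (intro mult_le_mono2) simp
  finally show False
    by simp
qed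

lemma p_dim_eq_length:
  fixes vs :: "('a, 'n::finite) polyvec list"
  assumes "p_basis p M vs"
  shows "p_dim p M = length vs"
  unfolding p_dim_def
  using assms p_basis_length_le by (intro the_equality) (auto intro: le_antisym)

end

section \<open>Expansions of minimal Groebner bases\<close>

lemma sorted_wrt_concat_map_upt:
  assumes "\<And>i. i < n \<Longrightarrow> sorted_wrt P (F i)"
    and "\<And>i j x y. i < j \<Longrightarrow> j < n \<Longrightarrow> x \<in> set (F i) \<Longrightarrow> y \<in> set (F j) \<Longrightarrow> P x y"
  shows "sorted_wrt P (concat (map F [0..<n]))"
  using assms by (induction n) (auto simp: sorted_wrt_append)

locale minimal_groebner = leading_keys p r R mle
  for p r and R :: "'a::nontriv itself"
    and mle :: "'q::finite monomial \<Rightarrow> 'q monomial \<Rightarrow> bool"  (infix \<open>\<preceq>\<close> 50) +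
  fixes M :: "('a, 'q) polyvec set" and gs :: "('a, 'q) polyvec list"
  assumes subspace: "Modules.module.subspace (*s) M"
    and minimal: "minimal_groebner_basis mle M (set gs)"
    and sorted: "sorted_wrt (\<lambda>g h. lm mle h \<prec> lm mle g) gs"
begin

abbreviation vord :: "('a, 'q) polyvec \<Rightarrow> nat" where
  "vord \<equiv> vec_order mle p"

lemma nth_in: "i < length gs \<Longrightarrow> gs ! i \<in> M"
  using minimal nth_mem unfolding minimal_groebner_basis_def groebner_basis_def by blast

lemma nth_nonzero: "i < length gs \<Longrightarrow> gs ! i \<noteq> 0"
  using minimal nth_mem unfolding minimal_groebner_basis_def groebner_basis_def by metis

lemma lm_decreasing: "i < j \<Longrightarrow> j < length gs \<Longrightarrow> lm mle (gs ! j) \<prec> lm mle (gs ! i)"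
  using sorted by (simp add: sorted_wrt_iff_nth_less)

text \<open>In one position the smaller leading monomial divides the larger. If the later element
  also had at least the order of the earlier one, its leading coefficient would divide the other,
  and it alone would reduce the earlier element.\<close>

lemma vord_decreasing:
  assumes "i < j" "j < length gs" "lpos mle (gs ! i) = lpos mle (gs ! j)"
  shows "vord (gs ! j) < vord (gs ! i)"
proof (rule ccontr)
  assume "\<not> ?thesis"
  then have "ord (lc mle (gs ! i)) \<le> ord (lc mle (gs ! j))"
    by (simp add: vec_order_def)
  then obtain t where t: "lc mle (gs ! i) = t * lc mle (gs ! j)"
    by (rule elem_order_le_imp_dvd)
  have less: "lm mle (gs ! j) \<prec> lm mle (gs ! i)"
    using assms by (intro lm_decreasing)
  then have "fst (lm mle (gs ! j)) \<le> fst (lm mle (gs ! i))"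
    using assms(3) by (subst same_pos_le_iff[symmetric]) (auto simp: lpos_def)
  then obtain \<alpha> where \<alpha>: "lm mle (gs ! i) = mon_shift \<alpha> (lm mle (gs ! j))"
    using assms(3) by (auto simp: mon_shift_def lpos_def prod_eq_iff nat_le_iff_add)
  have "lt mle (gs ! i) = monom t \<alpha> *s lt mle (gs ! j)"
    by (simp add: lt_def monom_scale_mon_term t \<alpha>)
  moreover have "gs ! j \<noteq> gs ! i"
    using less by auto
  ultimately have "reducible_mod mle (gs ! i) (set gs - {gs ! i})"
    using \<alpha> assms(2) unfolding reducible_mod_def
    by (intro exI[of _ 1] conjI exI[of _ "\<lambda>_. gs ! j"] exI[of _ "\<lambda>_. \<alpha>"] exI[of _ "\<lambda>_. t"]) auto
  then show False
    using minimal assms(1,2) unfolding minimal_groebner_basis_def by simp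
qed

lemma order_diff_le: "order_diff mle p gs j \<le> vord (gs ! j)"
  by (simp add: order_diff_def Let_def)

text \<open>Needed for every later element of the position, not just the next one, since vectors
  from any two blocks are compared. Orders decrease along the position, so the next element is the
  worst case.\<close>

lemma vord_minus_order_diff:
  assumes "i < j" "j < length gs" "lpos mle (gs ! i) = lpos mle (gs ! j)"
  shows "vord (gs ! j) + order_diff mle p gs i \<le> vord (gs ! i)"
proof -
  define I where "I = {k. i < k \<and> k < length gs \<and> lpos mle (gs ! k) = lpos mle (gs ! i)}"
  have I: "finite I" "j \<in> I"
    using assms by (auto simp: I_def)
  then have "Min I \<in> I" "Min I \<le> j"
    by (auto intro: Min_in)
  then have "vord (gs ! Min I) < vord (gs ! i)" "vord (gs ! j) \<le> vord (gs ! Min I)"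
    using vord_decreasing[of i "Min I"] vord_decreasing[of "Min I" j] assms
    by (auto simp: I_def le_less)
  moreover have "order_diff mle p gs i = vord (gs ! i) - vord (gs ! Min I)"
    using I(2) by (auto simp: order_diff_def Let_def I_def)
  ultimately show ?thesis
    by linarith
qed

text \<open>
  The vectors whose coefficients at the divisors of \<open>lm f\<close> are annihilated by \<open>p\<^bsup>ord f - 1\<^esup>\<close> form a
  submodule without \<open>lt f\<close>; hence it cannot contain the leading terms of all \<open>gs\<close>.
\<close>

lemma leading_divisor_exists:
  assumes "f \<in> M" "f \<noteq> 0"
  shows "\<exists>i<length gs. lpos mle (gs ! i) = lpos mle f \<and> lm mle (gs ! i) \<preceq> lm mle f \<and>
    vord f \<le> vord (gs ! i)"
proof (rule ccontr)
  assume none: "\<not> ?thesis"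
  let ?q = "of_nat (p ^ (vord f - 1)) :: 'a mod_ring"
  define H where "H = {h :: ('a, 'q) polyvec. \<forall>n\<le>fst (lm mle f). ?q * mon_coeff h (n, lpos mle f) = 0}"
  have "Modules.module.subspace (*s) H"
    unfolding module.subspace_def[OF module_vector_scalar_mult]
  proof (intro conjI ballI allI)
    show "0 \<in> H"
      by (simp add: H_def)
    show "x + y \<in> H" if "x \<in> H" "y \<in> H" for x y
      using that by (simp add: H_def mon_coeff_add distrib_left)
    \<comment> \<open>The product's coefficient at exponent n involves only coefficients of x at
      exponents up to n. This closure is why \<open>H\<close> constrains all divisors of the leading
      monomial of f.\<close>
    show "c *s x \<in> H" if "x \<in> H" for c x
      unfolding H_def
    proof (intro CollectI allI impI)
      fix n assume "n \<le> fst (lm mle f)"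
      then have 0: "?q * mon_coeff x (n - k, lpos mle f) = 0" for k
        using that by (simp add: H_def)
      have "?q * mon_coeff (c *s x) (n, lpos mle f) =
          (\<Sum>k\<le>n. coeff c k * (?q * mon_coeff x (n - k, lpos mle f)))"
        by (simp add: mon_coeff_scale sum_distrib_left mult.left_commute)
      then show "?q * mon_coeff (c *s x) (n, lpos mle f) = 0"
        by (simp only: 0) simp
    qed
  qed
  moreover have "lt mle ` (set gs - {0}) \<subseteq> H"
  proof
    fix h assume "h \<in> lt mle ` (set gs - {0})"
    then obtain g where "g \<in> set gs" "h = lt mle g"
      by auto
    then obtain i where i: "i < length gs" "h = lt mle (gs ! i)"
      by (metis in_set_conv_nth)
    show "h \<in> H"
      unfolding H_def
    proof (intro CollectI allI impI)
      fix n assume n: "n \<le> fst (lm mle f)"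
      show "?q * mon_coeff h (n, lpos mle f) = 0"
      proof (cases "lm mle (gs ! i) = (n, lpos mle f)")
        case True
        then have "lpos mle (gs ! i) = lpos mle f" "lm mle (gs ! i) \<preceq> lm mle f"
          using n by (simp_all add: lpos_def same_pos_le_iff)
        then have "\<not> vord f \<le> vord (gs ! i)"
          using none i(1) by blast
        then have "vord (gs ! i) \<le> vord f - 1"
          by linarith
        then show ?thesis
          unfolding i(2) lt_def mon_coeff_mon_term using True
          by (simp only: pow_mult_eq_0_iff vec_order_def if_True simp_thms)
      next
        case False
        then show ?thesis
          by (simp add: i(2) lt_def mon_coeff_mon_term)
      qed
    qed
  qed
  ultimately have "lt_module mle (set gs) \<subseteq> H"
    unfolding lt_module_def by (intro module.span_minimal[OF module_vector_scalar_mult])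
  moreover have "lt mle f \<in> lt_module mle M"
    unfolding lt_module_def using assms
    by (intro module.span_base[OF module_vector_scalar_mult]) auto
  moreover have "lt_module mle (set gs) = lt_module mle M"
    using minimal by (simp add: minimal_groebner_basis_def groebner_basis_def)
  ultimately have "lt mle f \<in> H"
    by blast
  then have "?q * mon_coeff (lt mle f) (lm mle f) = 0"
    unfolding H_def lpos_def by (metis (mono_tags, lifting) mem_Collect_eq order_refl prod.collapse)
  then have "?q * lc mle f = 0"
    by (simp add: lt_def mon_coeff_mon_term)
  \<comment> \<open>The order of f is positive because f is nonzero, so truncated subtraction is a
    true predecessor and the inequality is absurd.\<close>
  then have "vord f \<le> vord f - 1"
    by (simp only: pow_mult_eq_0_iff vec_order_def)
  then show False
    using assms(2) vec_order_eq_0_iff[of f] by simp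
qed

text \<open>Within a position, the block of \<open>g_i\<close> realizes the orders from that of
  \<open>g_i\<close> down to just above that of the next element. The right block belongs to the
  last divisor whose order still reaches that of f, with \<open>k\<close> the difference of
  orders.\<close>

lemma leading_divisor_expanded:
  assumes "f \<in> M" "f \<noteq> 0"
  obtains i k \<alpha> where "i < length gs" "k < order_diff mle p gs i"
    "lm mle f = mon_shift \<alpha> (lm mle (gs ! i))" "vord f = vord (gs ! i) - k"
proof -
  define J where "J = {i. i < length gs \<and> lpos mle (gs ! i) = lpos mle f \<and>
    lm mle (gs ! i) \<preceq> lm mle f \<and> vord f \<le> vord (gs ! i)}"
  have J: "finite J" "J \<noteq> {}"
    using leading_divisor_exists[OF assms] by (auto simp: J_def)
  \<comment> \<open>Later elements have smaller leading monomials, so those in the same position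
    also divide the leading monomial of f; they can fall outside \<open>J\<close> only by having too
    small an order.\<close>
  define i where "i = Max J"
  have i: "i < length gs" "lpos mle (gs ! i) = lpos mle f" "lm mle (gs ! i) \<preceq> lm mle f"
    "vord f \<le> vord (gs ! i)"
    using Max_in[OF J] by (simp_all add: J_def i_def)
  have maximal: "vord (gs ! n) < vord f"
    if "i < n" "n < length gs" "lpos mle (gs ! n) = lpos mle (gs ! i)" for n
  proof (rule ccontr)
    assume "\<not> ?thesis"
    moreover have "lm mle (gs ! n) \<preceq> lm mle f"
      using lm_decreasing[OF that(1,2)] i(3) by (metis mon.le_less mon.order.trans)
    ultimately have "n \<in> J"
      using that i(2) by (simp add: J_def)
    then have "n \<le> i"
      using J(1) by (simp add: i_def)
    with that show False
      by simp
  qed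
  have "vord f > 0"
    using assms(2) vec_order_eq_0_iff[of f] by simp
  have "vord (gs ! i) - vord f < order_diff mle p gs i"
  proof -
    define I where "I = {k. i < k \<and> k < length gs \<and> lpos mle (gs ! k) = lpos mle (gs ! i)}"
    show ?thesis
    proof (cases "I = {}")
      case True
      then show ?thesis
        using \<open>vord f > 0\<close> i(4) by (simp add: order_diff_def Let_def I_def)
    next
      case False
      then have "Min I \<in> I"
        by (intro Min_in) (simp_all add: I_def)
      then have "vord (gs ! Min I) < vord f"
        using maximal by (simp add: I_def)
      then show ?thesis
        using False i(4) by (simp add: order_diff_def Let_def I_def)
    qed
  qed
  moreover have "lm mle f = mon_shift (fst (lm mle f) - fst (lm mle (gs ! i))) (lm mle (gs ! i))"
    using i(2,3) by (simp add: lpos_def same_pos_le_iff mon_shift_def prod_eq_iff)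
  moreover have "vord f = vord (gs ! i) - (vord (gs ! i) - vord f)"
    using i(4) by simp
  ultimately show thesis
    using that i(1) by blast
qed

section \<open>The expanded sequence and its leading keys\<close>

lemma
  assumes "k < vord g"
  shows lm_pow_scale: "lm mle (of_nat (p ^ k) *s g) = lm mle g"
    and vord_pow_scale: "vord (of_nat (p ^ k) *s g) = vord g - k"
    and pow_scale_nonzero: "of_nat (p ^ k) *s g \<noteq> 0"
proof -
  let ?a = "of_nat (p ^ k) :: 'a mod_ring poly"
  have a: "degree ?a = 0" "lead_coeff ?a = of_nat (p ^ k)"
    by (simp_all only: of_nat_poly degree_pCons_0 coeff_pCons_0)
  have "lead_coeff ?a * lc mle g \<noteq> 0"
    unfolding a(2) pow_mult_eq_0_iff using assms by (simp add: vec_order_def)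
  note leading = lm_scale[OF this] lc_scale[OF this]
  show "lm mle (?a *s g) = lm mle g"
    using leading(1) a(1) by (simp only: mon_shift_0)
  show *: "vord (?a *s g) = vord g - k"
    unfolding vec_order_def leading(2) a(2) by (rule elem_order_pow_mult)
  show "?a *s g \<noteq> 0"
    using * assms vec_order_eq_0_iff[of "?a *s g"] by linarith
qed

lemma expanded_seq_eq:
  "expanded_seq mle p gs =
    concat (map (\<lambda>i. map (\<lambda>k. of_nat (p ^ k) *s gs ! i) [0..<order_diff mle p gs i]) [0..<length gs])"
  unfolding expanded_seq_def order_diffs_def
  by (rule arg_cong[of _ _ concat], rule map_cong) auto

lemma length_expanded_seq: "length (expanded_seq mle p gs) = sum_list (order_diffs mle p gs)"
  by (simp add: expanded_seq_eq length_concat order_diffs_def comp_def)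

text \<open>Within a block the leading monomial is fixed and each factor p lowers the order by one.
  Between blocks the leading monomial drops, and for equal positions the order ranges are disjoint
  because a block stops before reaching the orders of later ones.\<close>

lemma sorted_expanded_seq:
  "sorted_wrt (\<lambda>v w. key w \<prec>\<^sub>k key v \<and> (lpos mle v = lpos mle w \<longrightarrow> vord v \<noteq> vord w))
    (expanded_seq mle p gs)"
  unfolding expanded_seq_eq
proof (rule sorted_wrt_concat_map_upt)
  fix i assume "i < length gs"
  show "sorted_wrt (\<lambda>v w. key w \<prec>\<^sub>k key v \<and> (lpos mle v = lpos mle w \<longrightarrow> vord v \<noteq> vord w))
      (map (\<lambda>k. of_nat (p ^ k) *s gs ! i) [0..<order_diff mle p gs i])"
    unfolding sorted_wrt_iff_nth_less
  proof (intro allI impI)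
    fix k l assume "k < l"
      and "l < length (map (\<lambda>k. of_nat (p ^ k) *s gs ! i) [0..<order_diff mle p gs i])"
    then have l: "l < order_diff mle p gs i"
      by simp
    then have "l < vord (gs ! i)" "k < vord (gs ! i)"
      using order_diff_le[of i] \<open>k < l\<close> by auto
    then have "key (of_nat (p ^ l) *s gs ! i) \<prec>\<^sub>k key (of_nat (p ^ k) *s gs ! i) \<and>
        vord (of_nat (p ^ k) *s gs ! i) \<noteq> vord (of_nat (p ^ l) *s gs ! i)"
      unfolding key_def key_less_def using \<open>k < l\<close>
      by (simp add: lm_pow_scale vord_pow_scale del: of_nat_power) linarith
    then show "key (map (\<lambda>k. of_nat (p ^ k) *s gs ! i) [0..<order_diff mle p gs i] ! l)
        \<prec>\<^sub>k key (map (\<lambda>k. of_nat (p ^ k) *s gs ! i) [0..<order_diff mle p gs i] ! k) \<and>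
        (lpos mle (map (\<lambda>k. of_nat (p ^ k) *s gs ! i) [0..<order_diff mle p gs i] ! k) =
          lpos mle (map (\<lambda>k. of_nat (p ^ k) *s gs ! i) [0..<order_diff mle p gs i] ! l) \<longrightarrow>
        vord (map (\<lambda>k. of_nat (p ^ k) *s gs ! i) [0..<order_diff mle p gs i] ! k) \<noteq>
          vord (map (\<lambda>k. of_nat (p ^ k) *s gs ! i) [0..<order_diff mle p gs i] ! l))"
      using l \<open>k < l\<close> by (simp del: of_nat_power)
  qed
next
  fix i j v w
  assume ij: "i < j" "j < length gs"
    and "v \<in> set (map (\<lambda>k. of_nat (p ^ k) *s gs ! i) [0..<order_diff mle p gs i])"
    and "w \<in> set (map (\<lambda>k. of_nat (p ^ k) *s gs ! j) [0..<order_diff mle p gs j])"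
  then obtain k l where k: "k < order_diff mle p gs i" "v = of_nat (p ^ k) *s gs ! i"
    and l: "l < order_diff mle p gs j" "w = of_nat (p ^ l) *s gs ! j"
    by (auto simp del: of_nat_power)
  have "k < vord (gs ! i)" "l < vord (gs ! j)"
    using k(1) l(1) order_diff_le[of i] order_diff_le[of j] by simp_all
  then have v: "lm mle v = lm mle (gs ! i)" "vord v = vord (gs ! i) - k"
    and w: "lm mle w = lm mle (gs ! j)" "vord w = vord (gs ! j) - l"
    unfolding k(2) l(2) by (simp_all only: lm_pow_scale vord_pow_scale)
  have "vord w < vord v" if "lpos mle v = lpos mle w"
  proof -
    have "vord (gs ! j) + order_diff mle p gs i \<le> vord (gs ! i)"
      using that v(1) w(1) ij by (intro vord_minus_order_diff) (simp_all add: lpos_def)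
    then show ?thesis
      using v(2) w(2) k(1) by linarith
  qed
  moreover have "key w \<prec>\<^sub>k key v"
    using lm_decreasing[OF ij] v(1) w(1) by (simp add: key_less_def key_def)
  ultimately show "key w \<prec>\<^sub>k key v \<and> (lpos mle v = lpos mle w \<longrightarrow> vord v \<noteq> vord w)"
    by auto
qed

lemma set_expanded_seq:
  "set (expanded_seq mle p gs) =
    {of_nat (p ^ k) *s gs ! i |i k. i < length gs \<and> k < order_diff mle p gs i}"
  unfolding expanded_seq_eq by (auto simp del: of_nat_power) blast

lemma nonzero_expanded_seq: "0 \<notin> set (expanded_seq mle p gs)"
proof
  assume "0 \<in> set (expanded_seq mle p gs)"
  then obtain i k where "0 = of_nat (p ^ k) *s gs ! i" "k < order_diff mle p gs i"
    unfolding set_expanded_seq by blast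
  then show False
    using pow_scale_nonzero[of k "gs ! i"] order_diff_le[of i] by simp
qed

sublocale expanded: leading_p_basis p r R mle M "expanded_seq mle p gs"
proof
  show "Modules.module.subspace (*s) M"
    by (rule subspace)
  show "set (expanded_seq mle p gs) \<subseteq> M"
    unfolding set_expanded_seq using nth_in
    by (auto intro: module.subspace_scale[OF module_vector_scalar_mult subspace])
  show "0 \<notin> set (expanded_seq mle p gs)"
    by (rule nonzero_expanded_seq)
  show "key (expanded_seq mle p gs ! j) \<prec>\<^sub>k key (expanded_seq mle p gs ! i)"
    if "i < j" "j < length (expanded_seq mle p gs)" for i j
    using sorted_wrt_nth_less[OF sorted_expanded_seq that] by blast
  show "vord (expanded_seq mle p gs ! i) \<noteq> vord (expanded_seq mle p gs ! j)"
    if "i < j" "j < length (expanded_seq mle p gs)"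
      "lpos mle (expanded_seq mle p gs ! i) = lpos mle (expanded_seq mle p gs ! j)" for i j
    using sorted_wrt_nth_less[OF sorted_expanded_seq that(1,2)] that(3) by blast
  show "\<exists>j<length (expanded_seq mle p gs). \<exists>\<alpha>.
      lm mle f = mon_shift \<alpha> (lm mle (expanded_seq mle p gs ! j)) \<and>
      vord f = vord (expanded_seq mle p gs ! j)"
    if f: "f \<in> M" "f \<noteq> 0" for f
  proof -
    obtain i k \<alpha> where ik: "i < length gs" "k < order_diff mle p gs i"
      "lm mle f = mon_shift \<alpha> (lm mle (gs ! i))" "vord f = vord (gs ! i) - k"
      using leading_divisor_expanded[OF f] .
    have "of_nat (p ^ k) *s gs ! i \<in> set (expanded_seq mle p gs)"
      unfolding set_expanded_seq using ik(1,2) by blast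
    then obtain j where j: "j < length (expanded_seq mle p gs)"
      "expanded_seq mle p gs ! j = of_nat (p ^ k) *s gs ! i"
      by (meson in_set_conv_nth)
    have "k < vord (gs ! i)"
      using ik(2) order_diff_le[of i] by simp
    then have "lm mle (expanded_seq mle p gs ! j) = lm mle (gs ! i)"
      "vord (expanded_seq mle p gs ! j) = vord (gs ! i) - k"
      unfolding j(2) by (simp_all only: lm_pow_scale vord_pow_scale)
    then show ?thesis
      using j(1) ik(3,4) by metis
  qed
qed

lemma expanded_seq_nonempty:
  assumes "M \<noteq> {0}"
  shows "expanded_seq mle p gs \<noteq> []"
proof -
  have "0 \<in> M"
    by (rule module.subspace_0[OF module_vector_scalar_mult subspace])
  then obtain f where "f \<in> M" "f \<noteq> 0"
    using assms by blast
  then show ?thesis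
    using expanded.orders_cover by fastforce
qed

end

theorem theorem4p12:
  fixes p r :: nat
    and mle :: "'q::finite monomial \<Rightarrow> 'q monomial \<Rightarrow> bool"
    and M :: "('a::nontriv, 'q) polyvec set"
    and gs :: "('a, 'q) polyvec list"
  assumes "prime p" and "r \<ge> 1" and "CARD('a) = p ^ r"
    and "monomial_order mle"
    and "Modules.module.subspace (*s) M" and "M \<noteq> {0}"
    and "minimal_groebner_basis mle M (set gs)"
    and "sorted_wrt (\<lambda>g h. strict_part mle (lm mle h) (lm mle g)) gs"
  shows "p_PLM mle p M (set (expanded_seq mle p gs))
       \<and> p_basis p M (expanded_seq mle p gs)
       \<and> p_dim p M = sum_list (order_diffs mle p gs)"
proof -
  interpret minimal_groebner p r "TYPE('a)" mle M gs
    using assms by unfold_locales auto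
  have basis: "p_basis p M (expanded_seq mle p gs)"
    using assms(6) by (intro expanded.p_basis expanded_seq_nonempty)
  then show ?thesis
    using expanded.p_PLM[OF expanded_seq_nonempty[OF assms(6)]] p_dim_eq_length[OF basis]
    by (simp add: length_expanded_seq)
qed

end
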